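(* Fix a sufficiently small $\varepsilon>0$. Let $m,n\to\infty$ be integers with $n\le m=o(n^{1+\varepsilon})$, and let $\mathbf{s}=(s_1,\dots,s_m)$ and $\mathbf{t}=(t_1,\dots,t_n)$ be vectors of positive integers with $\sum_i s_i=\sum_j t_j$. Put $s=m^{-1}\sum_i s_i$, $t=n^{-1}\sum_j t_j$, and suppose $|s_i-s|=\mathcal{O}(n^{1/2+\varepsilon})$ uniformly in $i$ and $|t_j-t|=\mathcal{O}(m^{1/2+\varepsilon})$ uniformly in $j$. Let $\lambda=s/n=t/m$, with $\lambda\le1/2$ and $\lambda$ bounded away from $0$, and suppose $$\frac{(1-2\lambda)^2}{4\lambda(1-\lambda)}\left(1+\frac{5m}{6n}+\frac{5n}{6m}\right)\le \frac{\log m}{3}.$$ Let $G(\mathbf{s},\mathbf{t})$ be chosen uniformly at random from the labelled bipartite graphs with parts $U=\{u_1,\dots,u_m\}$ and $W=\{w_1,\dots,w_n\}$ in which $u_i$ has degree $s_i$ and $w_j$ has degree $t_j$. Then there is a constant $c>0$ such that, with probability $1-o(1)$, $$\big|e(A,B)-\lambda|A||B|\big|\le c\,(mn^{1/2+\varepsilon}+nm^{1/2+\varepsilon})$$ holds simultaneously for all subsets $A\subseteq U$ and $B\subseteq W$.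
   Context: $e(A,B)$ denotes the number of edges of the graph with one endpoint in $A$ and the other in $B$. $\lambda$ equals the density of the graph, i.e. the number of edges divided by $mn$. *)

theory Defs
  imports "HOL-Probability.Probability" "HOL-Library.Landau_Symbols"
begin

text \<open>
  A graph is given by its edge set, every edge being an unordered pair of vertices.
  The vertex \<open>u\<^sub>i\<close> is \<open>Inl i\<close> and the vertex \<open>w\<^sub>j\<close> is \<open>Inr j\<close>, with indices starting at 1.
\<close>

type_synonym vertex = "nat + nat"

definition part_U :: "nat \<Rightarrow> vertex set" where
  "part_U m = Inl ` {1..m}"

definition part_W :: "nat \<Rightarrow> vertex set" where
  "part_W n = Inr ` {1..n}"

definition bipartite_graphs :: "nat \<Rightarrow> nat \<Rightarrow> vertex set set set" where
  "bipartite_graphs m n = Pow {{u, w} |u w. u \<in> part_U m \<and> w \<in> part_W n}"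

definition vertex_degree :: "vertex set set \<Rightarrow> vertex \<Rightarrow> nat" where
  "vertex_degree E v = card {e \<in> E. v \<in> e}"

definition edges_between :: "vertex set set \<Rightarrow> vertex set \<Rightarrow> vertex set \<Rightarrow> nat" where
  "edges_between E A B = card {e \<in> E. \<exists>a\<in>A. \<exists>b\<in>B. e = {a, b}}"

definition graphs_with_degrees ::
    "nat \<Rightarrow> nat \<Rightarrow> (nat \<Rightarrow> nat) \<Rightarrow> (nat \<Rightarrow> nat) \<Rightarrow> vertex set set set" where
  "graphs_with_degrees m n s t =
     {E \<in> bipartite_graphs m n.
        (\<forall>i\<in>{1..m}. vertex_degree E (Inl i) = s i) \<and> (\<forall>j\<in>{1..n}. vertex_degree E (Inr j) = t j)}"

definition random_graph ::
    "nat \<Rightarrow> nat \<Rightarrow> (nat \<Rightarrow> nat) \<Rightarrow> (nat \<Rightarrow> nat) \<Rightarrow> vertex set set pmf" where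
  "random_graph m n s t = pmf_of_set (graphs_with_degrees m n s t)"

definition mean_degree :: "nat \<Rightarrow> (nat \<Rightarrow> nat) \<Rightarrow> real" where
  "mean_degree l d = (\<Sum>i=1..l. real (d i)) / real l"

text \<open>
  The density \<open>\<lambda> = s/n\<close>, where \<open>s\<close> is the mean of the degrees in \<open>U\<close>. It also equals \<open>t/m\<close>,
  because the two degree sums agree.
\<close>

definition edge_density :: "nat \<Rightarrow> nat \<Rightarrow> (nat \<Rightarrow> nat) \<Rightarrow> real" where
  "edge_density m n s = mean_degree m s / real n"

text \<open>
  The asymptotic regime: a sequence, indexed by \<open>k\<close>, of sizes \<open>m k\<close>, \<open>n k\<close> and degree vectors
  \<open>s k\<close>, \<open>t k\<close>. The constant \<open>K\<close> is the implied constant of the two uniform O-bounds and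
  \<open>\<delta>\<close> is the positive lower bound witnessing that the density is bounded away from 0.
  The bound \<open>\<delta> \<le> edge_density\<close> also excludes \<open>m k = 0\<close> and \<open>n k = 0\<close>, as division by 0 yields 0.
\<close>

definition admissible ::
    "real \<Rightarrow> real \<Rightarrow> real \<Rightarrow> (nat \<Rightarrow> nat) \<Rightarrow> (nat \<Rightarrow> nat) \<Rightarrow>
     (nat \<Rightarrow> nat \<Rightarrow> nat) \<Rightarrow> (nat \<Rightarrow> nat \<Rightarrow> nat) \<Rightarrow> bool" where
  "admissible \<epsilon> K \<delta> m n s t \<longleftrightarrow>
     filterlim m at_top sequentially \<and> filterlim n at_top sequentially \<and>
     (\<forall>k. n k \<le> m k) \<and>
     (\<lambda>k. real (m k)) \<in> o(\<lambda>k. real (n k) powr (1 + \<epsilon>)) \<and>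
     (\<forall>k. \<forall>i\<in>{1..m k}. s k i > 0) \<and>
     (\<forall>k. \<forall>j\<in>{1..n k}. t k j > 0) \<and>
     (\<forall>k. (\<Sum>i=1..m k. s k i) = (\<Sum>j=1..n k. t k j)) \<and>
     (\<forall>k. \<forall>i\<in>{1..m k}.
        \<bar>real (s k i) - mean_degree (m k) (s k)\<bar> \<le> K * real (n k) powr (1/2 + \<epsilon>)) \<and>
     (\<forall>k. \<forall>j\<in>{1..n k}.
        \<bar>real (t k j) - mean_degree (n k) (t k)\<bar> \<le> K * real (m k) powr (1/2 + \<epsilon>)) \<and>
     (\<forall>k. \<delta> \<le> edge_density (m k) (n k) (s k) \<and> edge_density (m k) (n k) (s k) \<le> 1/2) \<and>
     (\<forall>k. let l = edge_density (m k) (n k) (s k) in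
        (1 - 2 * l)\<^sup>2 / (4 * l * (1 - l)) *
        (1 + 5 * real (m k) / (6 * real (n k)) + 5 * real (n k) / (6 * real (m k)))
          \<le> ln (real (m k)) / 3)"

end

theory Submission
  imports Defs "HOL-Real_Asymp.Real_Asymp"
begin

text \<open>
  Identify a bipartite graph with the set of cells of a \<open>0\<close>-\<open>1\<close> matrix, and let every cell be chosen
  independently with probability \<open>\<lambda>\<close>. Matrices with the same margins are equally likely in this model,
  so the probability that a random matrix with margins \<open>s, t\<close> deviates by \<open>x\<close> on some \<open>A \<times> B\<close> is at
  most the unconditional probability, which is at most \<open>2 ^ (m + n + 1) exp (- x\<^sup>2 / (4 m n))\<close> by
  Chernoff and a union bound, divided by the probability of the margins \<open>s, t\<close>. For \<open>x\<close> of the order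
  in the theorem, a crude lower bound \<open>exp (- C (m n\<^bsup>2\<epsilon>\<^esup> + n m\<^bsup>2\<epsilon>\<^esup>))\<close> for the latter is enough, so
  no asymptotic enumeration of graphs by degrees is needed.

  For the lower bound, there are only \<open>(n + 1) ^ m (m + 1) ^ n\<close> margins, so some margins \<open>s', t'\<close> close
  to the mean have a large probability. They are transformed into \<open>s, t\<close> by at most \<open>m + n\<close> transfers
  of degree between two rows (or columns). Given all other rows and the union and intersection of the
  two rows, which differ in \<open>b\<close> places, a transfer replaces a binomial coefficient \<open>b choose x\<close> by
  \<open>b choose x'\<close> with \<open>x, x'\<close> at distance \<open>O(n\<^bsup>1/2+\<epsilon>\<^esup>)\<close> from \<open>b / 2\<close>. Whenever \<open>b\<close> is of order \<open>n\<close>,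
  this costs a factor \<open>exp (- O(n\<^bsup>2\<epsilon>\<^esup>))\<close> only; and \<open>b\<close> is of order \<open>n\<close> with probability bounded below.
\<close>

section \<open>Resampling two rows of a matrix with given margins\<close>

text \<open>A 0-1 matrix is the relation of its ones, so rows and columns are relational images and
  transposition is \<open>converse\<close>.\<close>

definition margin_class :: "'a set \<Rightarrow> 'b set \<Rightarrow> ('a \<Rightarrow> nat) \<Rightarrow> ('b \<Rightarrow> nat) \<Rightarrow> ('a \<times> 'b) set set" where
  "margin_class I J s t =
     {G. G \<subseteq> I \<times> J \<and> (\<forall>i\<in>I. card (G `` {i}) = s i) \<and> (\<forall>j\<in>J. card (G\<inverse> `` {j}) = t j)}"

definition row_diff :: "'a \<Rightarrow> 'a \<Rightarrow> ('a \<times> 'b) set \<Rightarrow> 'b set" where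
  "row_diff p q G = sym_diff (G `` {p}) (G `` {q})"

text \<open>Everything that a resampling of rows \<open>p\<close> and \<open>q\<close> leaves fixed:
  the other rows, the common ones of the two rows, and the positions where exactly one of them has a
  one.\<close>

definition row_key :: "'a \<Rightarrow> 'a \<Rightarrow> ('a \<times> 'b) set \<Rightarrow> ('a \<times> 'b) set \<times> 'b set \<times> 'b set" where
  "row_key p q G = ({e \<in> G. fst e \<noteq> p \<and> fst e \<noteq> q}, G `` {p} \<inter> G `` {q}, row_diff p q G)"

text \<open>The matrices sharing a key with \<open>G\<close> are parametrised by the set
  \<open>X\<close> of disputed positions given to row \<open>p\<close>; row \<open>q\<close>
  receives the rest.\<close>

definition reglue :: "'a \<Rightarrow> 'a \<Rightarrow> ('a \<times> 'b) set \<Rightarrow> 'b set \<Rightarrow> ('a \<times> 'b) set" where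
  "reglue p q G X =
     {e \<in> G. fst e \<noteq> p \<and> fst e \<noteq> q} \<union> {p} \<times> (G `` {p} \<inter> G `` {q} \<union> X)
       \<union> {q} \<times> (G `` {p} \<inter> G `` {q} \<union> (row_diff p q G - X))"

lemma finite_margin_class:
  assumes "finite I" "finite J"
  shows "finite (margin_class I J s t)"
  by (rule finite_subset[of _ "Pow (I \<times> J)"]) (auto simp: margin_class_def assms)

lemma row_reglue:
  assumes "p \<noteq> q"
  shows "reglue p q G X `` {p} = G `` {p} \<inter> G `` {q} \<union> X"
    and "reglue p q G X `` {q} = G `` {p} \<inter> G `` {q} \<union> (row_diff p q G - X)"
    and "i \<noteq> p \<Longrightarrow> i \<noteq> q \<Longrightarrow> reglue p q G X `` {i} = G `` {i}"
  using assms by (auto simp: reglue_def)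

lemma row_key_reglue:
  assumes "p \<noteq> q" "X \<subseteq> row_diff p q G"
  shows "row_key p q (reglue p q G X) = row_key p q G"
proof -
  have "{e \<in> reglue p q G X. fst e \<noteq> p \<and> fst e \<noteq> q} = {e \<in> G. fst e \<noteq> p \<and> fst e \<noteq> q}"
    by (auto simp: reglue_def)
  moreover have "row_diff p q (reglue p q G X) = row_diff p q G"
    using assms unfolding row_diff_def row_reglue[OF assms(1)] by blast
  moreover have "reglue p q G X `` {p} \<inter> reglue p q G X `` {q} = G `` {p} \<inter> G `` {q}"
    using assms unfolding row_diff_def row_reglue[OF assms(1)] by blast
  ultimately show ?thesis
    by (simp add: row_key_def)
qed

text \<open>The parameter can be read off from row \<open>p\<close> of \<open>H\<close>, so gluing
  reaches every matrix with the same key.\<close>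

lemma reglue_of_row_key_eq:
  assumes "p \<noteq> q" "row_key p q H = row_key p q G"
  shows "H = reglue p q G (H `` {p} \<inter> row_diff p q G)"
proof -
  define R where "R = {e \<in> H. fst e \<noteq> p \<and> fst e \<noteq> q}"
  have R: "R = {e \<in> G. fst e \<noteq> p \<and> fst e \<noteq> q}"
    and C: "H `` {p} \<inter> H `` {q} = G `` {p} \<inter> G `` {q}"
    and D: "row_diff p q H = row_diff p q G"
    using assms by (auto simp: row_key_def R_def)
  have "H = R \<union> {p} \<times> H `` {p} \<union> {q} \<times> H `` {q}"
    by (auto simp: R_def)
  also have "H `` {p} = G `` {p} \<inter> G `` {q} \<union> (H `` {p} \<inter> row_diff p q G)"
    using C[symmetric] D[symmetric] unfolding row_diff_def by blast
  also have "H `` {q} = G `` {p} \<inter> G `` {q} \<union> (row_diff p q G - (H `` {p} \<inter> row_diff p q G))"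
    using C[symmetric] D[symmetric] unfolding row_diff_def by blast
  finally show ?thesis
    unfolding reglue_def R by (metis (no_types, lifting))
qed

lemma row_key_eq_subset:
  assumes "p \<noteq> q" "row_key p q H = row_key p q G" "G \<subseteq> I \<times> J" "p \<in> I" "q \<in> I"
  shows "H \<subseteq> I \<times> J"
  by (subst reglue_of_row_key_eq[OF assms(1,2)]) (use assms(3-5) in \<open>auto simp: reglue_def row_diff_def\<close>)

text \<open>A common position counts twice and a disputed one once, whichever of the two rows holds
  it. Column sums are thus functions of the key, and resampling preserves them.\<close>

lemma card_col_row_key:
  assumes "p \<noteq> q" "finite G"
  shows "card (G\<inverse> `` {j}) = card {i. (i, j) \<in> fst (row_key p q G)}
           + (if j \<in> fst (snd (row_key p q G)) then 2 else if j \<in> snd (snd (row_key p q G)) then 1 else 0)"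
proof -
  have fin: "finite {i. (i, j) \<in> G}"
    by (rule finite_subset[of _ "fst ` G"]) (auto simp: assms image_iff, force)
  have "G\<inverse> `` {j} = {i. (i, j) \<in> G \<and> i \<noteq> p \<and> i \<noteq> q} \<union> {i \<in> {p, q}. (i, j) \<in> G}"
    by auto
  then have "card (G\<inverse> `` {j}) = card {i. (i, j) \<in> G \<and> i \<noteq> p \<and> i \<noteq> q} + card {i \<in> {p, q}. (i, j) \<in> G}"
    by (simp only:) (rule card_Un_disjoint, auto intro: finite_subset[OF _ fin])
  moreover have "{i \<in> {p, q}. (i, j) \<in> G} =
      (if (p, j) \<in> G then {p} else {}) \<union> (if (q, j) \<in> G then {q} else {})"
    by auto
  ultimately show ?thesis
    using assms(1) by (auto simp: row_key_def row_diff_def)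
qed

lemma card_row_pair:
  assumes "finite G"
  shows "card (G `` {p}) + card (G `` {q}) = 2 * card (G `` {p} \<inter> G `` {q}) + card (row_diff p q G)"
proof -
  have fin: "finite (G `` {i})" for i
    by (rule finite_subset[of _ "snd ` G"]) (auto simp: assms image_iff, force)
  have "card (row_diff p q G) = card (G `` {p} - G `` {q}) + card (G `` {q} - G `` {p})"
    unfolding row_diff_def by (rule card_Un_disjoint) (auto simp: fin)
  moreover have "card (G `` {p}) = card (G `` {p} - G `` {q}) + card (G `` {p} \<inter> G `` {q})"
    by (subst card_Un_disjoint[symmetric]) (auto simp: fin intro: arg_cong[where f = card])
  moreover have "card (G `` {q}) = card (G `` {q} - G `` {p}) + card (G `` {p} \<inter> G `` {q})"
    by (subst card_Un_disjoint[symmetric]) (auto simp: fin intro: arg_cong[where f = card])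
  ultimately show ?thesis by simp
qed

text \<open>The key fixes the other rows and the column sums, so the only constraint left on
  \<open>X\<close> is its size; the sum of row \<open>q\<close> follows from that of row
  \<open>p\<close>. Having \<open>s'\<close> next to \<open>s\<close> describes, around the same
  \<open>G\<close>, the fibers before and after a transfer.\<close>

lemma row_key_fiber:
  assumes "finite I" "finite J" "p \<in> I" "q \<in> I" "p \<noteq> q" "G \<in> margin_class I J s t"
    and s': "\<And>i. i \<in> I \<Longrightarrow> i \<noteq> p \<Longrightarrow> i \<noteq> q \<Longrightarrow> s' i = s i" "s' p + s' q = s p + s q"
  shows "{H \<in> margin_class I J s' t. row_key p q H = row_key p q G}
           = reglue p q G ` {X. X \<subseteq> row_diff p q G \<and> card (G `` {p} \<inter> G `` {q}) + card X = s' p}"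
    (is "?L = ?g ` ?R")
proof -
  let ?C = "G `` {p} \<inter> G `` {q}" and ?D = "row_diff p q G"
  have G: "G \<subseteq> I \<times> J" "\<And>i. i \<in> I \<Longrightarrow> card (G `` {i}) = s i" "\<And>j. j \<in> J \<Longrightarrow> card (G\<inverse> `` {j}) = t j"
    using assms(6) by (auto simp: margin_class_def)
  have finG: "finite G" using G(1) assms(1,2) by (meson finite_SigmaI finite_subset)
  have finC: "finite ?C" and finD: "finite ?D"
    using G(1) by (auto intro!: finite_subset[OF _ assms(2)] simp: row_diff_def)
  have disj: "?C \<inter> ?D = {}" by (auto simp: row_diff_def)
  have "?L \<subseteq> ?g ` ?R"
  proof
    fix H assume "H \<in> ?L"
    then have H: "H \<in> margin_class I J s' t" and k: "row_key p q H = row_key p q G" by auto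
    let ?X = "H `` {p} \<inter> ?D"
    have "H = ?g ?X" by (rule reglue_of_row_key_eq[OF assms(5) k])
    then have "H `` {p} = ?C \<union> ?X" by (metis row_reglue(1)[OF assms(5)])
    then have "card (H `` {p}) = card ?C + card ?X"
      by (metis (no_types, lifting) card_Un_disjoint disj finC finD finite_Int inf.assoc inf.commute inf_bot_right)
    moreover have "card (H `` {p}) = s' p" using H assms(3) by (auto simp: margin_class_def)
    ultimately show "H \<in> ?g ` ?R" using \<open>H = ?g ?X\<close> by auto
  qed
  moreover have "?g ` ?R \<subseteq> ?L"
  proof clarsimp
    fix X assume X: "X \<subseteq> ?D" and cX: "card ?C + card X = s' p"
    let ?H = "?g X"
    have k: "row_key p q ?H = row_key p q G" by (rule row_key_reglue[OF assms(5) X])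
    have sub: "?H \<subseteq> I \<times> J" by (rule row_key_eq_subset[OF assms(5) k G(1) assms(3,4)])
    have finH: "finite ?H" using sub assms(1,2) by (meson finite_SigmaI finite_subset)
    have cp: "card (?H `` {p}) = s' p"
      unfolding row_reglue(1)[OF assms(5)] cX[symmetric]
      by (rule card_Un_disjoint) (use finC finD X disj in \<open>auto intro: finite_subset\<close>)
    have "card (?H `` {p}) + card (?H `` {q}) = card (G `` {p}) + card (G `` {q})"
      unfolding card_row_pair[OF finH] card_row_pair[OF finG] using k by (simp add: row_key_def)
    then have cq: "card (?H `` {q}) = s' q" using cp G(2) assms(3,4) s'(2) by simp
    have "card (?H `` {i}) = s' i" if "i \<in> I" for i
      using that cp cq G(2) s'(1) row_reglue(3)[OF assms(5)] by metis
    moreover have "card (?H\<inverse> `` {j}) = t j" if "j \<in> J" for j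
      using card_col_row_key[OF assms(5) finH, of j] card_col_row_key[OF assms(5) finG, of j] k G(3)[OF that]
      by simp
    ultimately show "?H \<in> margin_class I J s' t \<and> row_key p q ?H = row_key p q G"
      using sub k by (simp add: margin_class_def)
  qed
  ultimately show ?thesis by blast
qed

lemma inj_on_reglue:
  assumes "p \<noteq> q"
  shows "inj_on (reglue p q G) (Pow (row_diff p q G))"
proof (rule inj_onI)
  fix X Y assume *: "X \<in> Pow (row_diff p q G)" "Y \<in> Pow (row_diff p q G)" "reglue p q G X = reglue p q G Y"
  then have "G `` {p} \<inter> G `` {q} \<union> X = G `` {p} \<inter> G `` {q} \<union> Y"
    by (metis row_reglue(1)[OF assms])
  with *(1,2) show "X = Y" unfolding row_diff_def by blast
qed

section \<open>Fiberwise counting and ratios of nearby binomial coefficients\<close>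

text \<open>Only keys attained on \<open>S\<close> are summed over; the fibers of \<open>T\<close>
  over them are disjoint, and \<open>T\<close> may contain more.\<close>

lemma card_le_by_fibers:
  fixes \<rho> :: real
  assumes "finite S" "finite T"
    and "\<And>x. x \<in> S \<Longrightarrow> \<rho> * real (card {y \<in> S. k y = k x}) \<le> real (card {y \<in> T. k y = k x})"
  shows "\<rho> * real (card S) \<le> real (card T)"
proof -
  have "real (card S) = (\<Sum>z\<in>k ` S. real (card {y \<in> S. k y = z}))"
    using sum.image_gen[OF assms(1), of "\<lambda>_. 1 :: real" k] by simp
  then have "\<rho> * real (card S) = (\<Sum>z\<in>k ` S. \<rho> * real (card {y \<in> S. k y = z}))"
    by (simp add: sum_distrib_left)
  also have "\<dots> \<le> (\<Sum>z\<in>k ` S. real (card {y \<in> T. k y = z}))"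
    by (rule sum_mono) (use assms(3) in auto)
  also have "\<dots> = real (card (\<Union>z\<in>k ` S. {y \<in> T. k y = z}))"
    by (subst card_UN_disjoint) (use assms in auto)
  also have "\<dots> \<le> real (card T)"
    by (intro of_nat_mono card_mono) (use assms in auto)
  finally show ?thesis .
qed

text \<open>Consecutive coefficients have ratio \<open>(b - x) / (x + 1)\<close>, and
  \<open>x + 1 \<le> x' \<le> (b + L) / 2\<close> on the way up, so each ratio is at least
  \<open>(b - L) / (b + L)\<close>.\<close>

lemma binomial_ratio_up:
  fixes L :: real
  assumes "x \<le> x'" "x' \<le> b" "\<bar>2 * real x' - real b\<bar> \<le> L" "L < b"
  shows "((real b - L) / (real b + L)) ^ (x' - x) * real (b choose x) \<le> real (b choose x')"
  using assms(1,2,3)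
proof (induction "x' - x" arbitrary: x)
  case 0
  then show ?case by simp
next
  case (Suc k)
  let ?r = "(real b - L) / (real b + L)"
  have L: "L \<ge> 0" using assms(3) by linarith
  have r0: "0 \<le> ?r" using assms(4) L by simp
  have "Suc x \<le> x'" using Suc(2) by simp
  have IH: "?r ^ (x' - Suc x) * real (b choose Suc x) \<le> real (b choose x')"
    by (rule Suc(1)) (use Suc in auto)
  have "Suc x * (b choose Suc x) = (b - x) * (b choose x)"
    by (metis binomial_absorb_comp binomial_absorption mult.commute)
  then have eq: "real (Suc x) * real (b choose Suc x) = (real b - real x) * real (b choose x)"
    using \<open>Suc x \<le> x'\<close> assms(2) by (metis Suc_leD le_trans of_nat_diff of_nat_mult)
  have le: "?r * real (Suc x) \<le> real b - real x"
  proof -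
    have "real (Suc x) \<le> real x'" using \<open>Suc x \<le> x'\<close> by (simp only: of_nat_le_iff)
    then have "2 * real (Suc x) \<le> 2 * real x'" by simp
    also have "\<dots> \<le> b + L" using assms(3) by linarith
    finally have "2 * real (Suc x) \<le> b + L" .
    then have "?r * (2 * real (Suc x)) \<le> ?r * (b + L)" by (rule mult_left_mono[OF _ r0])
    also have "\<dots> = b - L" using assms(4) L by simp
    also have "\<dots> \<le> 2 * (real b - real x)"
      using \<open>2 * real (Suc x) \<le> b + L\<close> by simp
    finally have "2 * (?r * real (Suc x)) \<le> 2 * (real b - real x)" by (simp only: mult.left_commute)
    then show ?thesis by (rule mult_left_le_imp_le) simp
  qed
  have "?r * real (b choose x) * real (Suc x) \<le> real (b choose Suc x) * real (Suc x)"
    using mult_right_mono[OF le, of "real (b choose x)"] eq by (simp add: mult_ac)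
  then have "?r * real (b choose x) \<le> real (b choose Suc x)"
    by (rule mult_right_le_imp_le) simp
  then have "?r ^ (x' - Suc x) * (?r * real (b choose x)) \<le> ?r ^ (x' - Suc x) * real (b choose Suc x)"
    by (rule mult_left_mono) (simp add: r0)
  moreover have "?r ^ (x' - x) = ?r ^ (x' - Suc x) * ?r"
    using \<open>Suc x \<le> x'\<close> by (metis Suc_diff_le diff_Suc_Suc power_Suc2)
  ultimately show ?case using IH by (simp only: mult.assoc)
qed

text \<open>At most \<open>L\<close> unit steps are needed, each costing a factor no smaller than
  \<open>exp (- (4 * L / b))\<close>.\<close>

lemma binomial_ratio:
  fixes L :: real
  assumes "x \<le> b" "x' \<le> b" "\<bar>2 * real x - real b\<bar> \<le> L" "\<bar>2 * real x' - real b\<bar> \<le> L" "4 * L \<le> b" "0 < b"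
  shows "exp (- (4 * L\<^sup>2 / b)) * real (b choose x) \<le> real (b choose x')"
proof -
  let ?r = "(real b - L) / (real b + L)"
  have L: "L \<ge> 0" "L < b" using assms by linarith+
  have r1: "?r \<le> 1" "0 < ?r" using L by (simp_all add: field_simps)
  have main: "exp (- (4 * L\<^sup>2 / b)) * real (b choose x) \<le> real (b choose x')"
    if "x \<le> x'" "x' \<le> b" "\<bar>2 * real x - real b\<bar> \<le> L" "\<bar>2 * real x' - real b\<bar> \<le> L" for x x'
  proof -
    have "exp (- (4 * L / b)) \<le> ?r"
    proof -
      have "exp (4 * L / b) \<ge> 1 + 4 * L / b" by (rule exp_ge_add_one_self)
      moreover have "(b + L) / (b - L) \<le> 1 + 4 * L / b"
      proof -
        have "4 * L * L \<le> b * L" using assms(5) L by (intro mult_right_mono) auto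
        moreover have "0 \<le> L * L" by simp
        ultimately have "2 * L * L \<le> b * L" by linarith
        then show ?thesis using L by (simp add: field_simps)
      qed
      ultimately have "(b + L) / (b - L) \<le> exp (4 * L / b)" by linarith
      then have "inverse (exp (4 * L / b)) \<le> inverse ((b + L) / (b - L))"
        using L by (intro le_imp_inverse_le) auto
      then show ?thesis by (simp add: exp_minus)
    qed
    then have "exp (- (4 * L / b)) ^ (x' - x) \<le> ?r ^ (x' - x)"
      by (rule power_mono) simp
    moreover have "exp (- (4 * L\<^sup>2 / b)) \<le> exp (- (4 * L / b)) ^ (x' - x)"
    proof -
      \<comment> \<open>\<open>2 * x\<close> and \<open>2 * x'\<close> both lie within
        \<open>L\<close> of \<open>b\<close>, so \<open>x\<close> and \<open>x'\<close> are at most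
        \<open>L\<close> apart.\<close>
      have "real (x' - x) \<le> L" using that by (simp add: of_nat_diff)
      then have "real (x' - x) * (4 * L / b) \<le> L * (4 * L / b)"
        by (rule mult_right_mono) (use L in simp)
      also have "\<dots> = 4 * L\<^sup>2 / b" by (simp add: power2_eq_square)
      finally show ?thesis by (simp flip: exp_of_nat_mult)
    qed
    ultimately have "exp (- (4 * L\<^sup>2 / b)) * real (b choose x) \<le> ?r ^ (x' - x) * real (b choose x)"
      by (intro mult_right_mono) auto
    also have "\<dots> \<le> real (b choose x')"
      by (rule binomial_ratio_up) (use that L in auto)
    finally show ?thesis .
  qed
  show ?thesis
  proof (cases "x \<le> x'")
    case True
    then show ?thesis using main assms by blast
  next
    case False
    \<comment> \<open>Replacing \<open>x\<close> by \<open>b - x\<close> reverses the order and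
      leads back to the increasing case.\<close>
    have "exp (- (4 * L\<^sup>2 / b)) * real (b choose (b - x)) \<le> real (b choose (b - x'))"
      by (rule main) (use False assms in \<open>auto simp: of_nat_diff\<close>)
    then show ?thesis using assms(1,2) by (metis binomial_symmetric)
  qed
qed

text \<open>The bound on the intersection keeps the natural subtraction honest: if it failed, the
  fiber would be empty while the truncated binomial coefficient would be 1.\<close>

lemma card_row_key_fiber:
  assumes "finite I" "finite J" "p \<in> I" "q \<in> I" "p \<noteq> q" "G \<in> margin_class I J s t"
    and "\<And>i. i \<in> I \<Longrightarrow> i \<noteq> p \<Longrightarrow> i \<noteq> q \<Longrightarrow> s' i = s i" "s' p + s' q = s p + s q"
    and "card (G `` {p} \<inter> G `` {q}) \<le> s' p"
  shows "card {H \<in> margin_class I J s' t. row_key p q H = row_key p q G}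
           = card (row_diff p q G) choose (s' p - card (G `` {p} \<inter> G `` {q}))"
proof -
  have G: "G \<subseteq> I \<times> J" using assms(6) by (auto simp: margin_class_def)
  have finD: "finite (row_diff p q G)"
    using G by (auto intro!: finite_subset[OF _ assms(2)] simp: row_diff_def)
  have "{X. X \<subseteq> row_diff p q G \<and> card (G `` {p} \<inter> G `` {q}) + card X = s' p}
      = {X. X \<subseteq> row_diff p q G \<and> card X = s' p - card (G `` {p} \<inter> G `` {q})}"
    using assms(9) by auto
  moreover have "inj_on (reglue p q G) {X. X \<subseteq> row_diff p q G \<and> card X = s' p - card (G `` {p} \<inter> G `` {q})}"
    by (rule inj_on_subset[OF inj_on_reglue[OF assms(5)]]) auto
  ultimately show ?thesis
    using row_key_fiber[of I J p q G s t s', OF assms(1-8)] by (simp add: card_image n_subsets finD)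
qed

lemma margin_class_row_diff:
  assumes "finite I" "finite J" "p \<in> I" "q \<in> I" "G \<in> margin_class I J s t"
  shows "card (G `` {p} \<inter> G `` {q}) \<le> s p"
    and "s p + s q = 2 * card (G `` {p} \<inter> G `` {q}) + card (row_diff p q G)"
    and "card (row_diff p q G) \<le> card J"
proof -
  have G: "G \<subseteq> I \<times> J" and s: "card (G `` {p}) = s p" "card (G `` {q}) = s q"
    using assms(3-5) by (auto simp: margin_class_def)
  have fin: "finite G" "finite (G `` {p})"
    using G assms(1,2) by (auto intro: finite_subset)
  show "card (G `` {p} \<inter> G `` {q}) \<le> s p"
    using card_mono[OF fin(2), of "G `` {p} \<inter> G `` {q}"] s by simp
  show "s p + s q = 2 * card (G `` {p} \<inter> G `` {q}) + card (row_diff p q G)"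
    using card_row_pair[OF fin(1), of p q] s by simp
  show "card (row_diff p q G) \<le> card J"
    by (rule card_mono[OF assms(2)]) (use G in \<open>auto simp: row_diff_def\<close>)
qed

text \<open>Conditioning on the row key, row \<open>p\<close> is a uniformly random subset of given size
  of the positions where the rows \<open>p\<close> and \<open>q\<close> differ.\<close>

lemma move_from_spread_rows:
  fixes L b\<^sub>0 :: real
  assumes fin: "finite I" "finite J" and pq: "p \<in> I" "q \<in> I" "p \<noteq> q"
    and s': "\<And>i. i \<in> I \<Longrightarrow> i \<noteq> p \<Longrightarrow> i \<noteq> q \<Longrightarrow> s' i = s i" "s' p + s' q = s p + s q"
    and L: "\<bar>real (s p) - real (s q)\<bar> \<le> L" "\<bar>real (s' p) - real (s' q)\<bar> \<le> L"
    and b0: "4 * L \<le> b\<^sub>0" "0 < b\<^sub>0"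
  shows "exp (- (4 * L\<^sup>2 / b\<^sub>0)) * card {G \<in> margin_class I J s t. b\<^sub>0 \<le> card (row_diff p q G)}
           \<le> card (margin_class I J s' t)"
proof (rule card_le_by_fibers[where k = "row_key p q"])
  fix G assume "G \<in> {G \<in> margin_class I J s t. b\<^sub>0 \<le> card (row_diff p q G)}"
  then have G: "G \<in> margin_class I J s t" and b: "b\<^sub>0 \<le> card (row_diff p q G)" by auto
  let ?b = "card (row_diff p q G)" and ?c = "card (G `` {p} \<inter> G `` {q})"
  note c = margin_class_row_diff[OF fin pq(1,2) G]
  have "2 * real ?c + real ?b = real (s p) + real (s q)"
    using c(2) by (simp flip: of_nat_add)
  moreover have "real (s p) + real (s q) = real (s' p) + real (s' q)"
    using s'(2) by (simp flip: of_nat_add)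
  \<comment> \<open>The free part of row \<open>p\<close> has size \<open>s p - ?c\<close>, and
    twice this minus \<open>?b\<close> is \<open>s p - s q\<close>. Closeness of the two row sums is
    therefore closeness to the middle of the binomial row.\<close>
  ultimately have sums: "2 * real (s p) - 2 * real ?c - real ?b = real (s p) - real (s q)"
    "2 * real (s' p) - 2 * real ?c - real ?b = real (s' p) - real (s' q)" by linarith+
  have "L \<ge> 0" using L by linarith
  have cs': "?c \<le> s' p" using sums(2) L(2) b0 b \<open>L \<ge> 0\<close> by linarith
  have xb: "s p - ?c \<le> ?b" "s' p - ?c \<le> ?b" using c(1,2) cs' s'(2) sums L b b0 by linarith+
  \<comment> \<open>A larger difference \<open>?b\<close> only improves the ratio bound, so
    \<open>b\<^sub>0\<close> can replace it.\<close>
  have "exp (- (4 * L\<^sup>2 / b\<^sub>0)) \<le> exp (- (4 * L\<^sup>2 / ?b))"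
    using b b0 by (simp add: divide_left_mono)
  then have "exp (- (4 * L\<^sup>2 / b\<^sub>0)) * (?b choose (s p - ?c)) \<le> exp (- (4 * L\<^sup>2 / ?b)) * (?b choose (s p - ?c))"
    by (rule mult_right_mono) simp
  also have "\<dots> \<le> ?b choose (s' p - ?c)"
    by (rule binomial_ratio) (use xb c(1) cs' sums L b b0 in \<open>auto simp: of_nat_diff\<close>)
  finally have main: "exp (- (4 * L\<^sup>2 / b\<^sub>0)) * (?b choose (s p - ?c)) \<le> ?b choose (s' p - ?c)" .
  have "card {H \<in> {G \<in> margin_class I J s t. b\<^sub>0 \<le> card (row_diff p q G)}. row_key p q H = row_key p q G}
      \<le> card {H \<in> margin_class I J s t. row_key p q H = row_key p q G}"
    by (rule card_mono) (auto simp: finite_margin_class fin)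
  also have "\<dots> = ?b choose (s p - ?c)"
    by (rule card_row_key_fiber[of I J p q G s t s, OF fin pq G _ _ c(1)]) auto
  finally have "exp (- (4 * L\<^sup>2 / b\<^sub>0)) *
      card {H \<in> {G \<in> margin_class I J s t. b\<^sub>0 \<le> card (row_diff p q G)}. row_key p q H = row_key p q G}
      \<le> exp (- (4 * L\<^sup>2 / b\<^sub>0)) * (?b choose (s p - ?c))"
    by (intro mult_left_mono) auto
  also note main
  finally show "exp (- (4 * L\<^sup>2 / b\<^sub>0)) *
      card {H \<in> {G \<in> margin_class I J s t. b\<^sub>0 \<le> card (row_diff p q G)}. row_key p q H = row_key p q G}
      \<le> card {H \<in> margin_class I J s' t. row_key p q H = row_key p q G}"
    using card_row_key_fiber[of I J p q G s t s', OF fin pq G s' cs'] by simp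
qed (auto simp: finite_margin_class fin)

section \<open>Random subsets far from a given set\<close>

text \<open>Points below the threshold \<open>a * B\<close> contribute at most \<open>a * B\<close>
  each and the others at most \<open>B\<close>, so the sum forces many of the latter.\<close>

lemma reverse_markov:
  fixes f :: "'a \<Rightarrow> real"
  assumes "finite S" "\<And>x. x \<in> S \<Longrightarrow> f x \<le> B" "0 \<le> a" "0 < B"
    and "(\<Sum>x\<in>S. f x) \<ge> 2 * a * B * card S"
  shows "a * card S \<le> card {x \<in> S. a * B \<le> f x}"
proof -
  let ?T = "{x \<in> S. a * B \<le> f x}"
  have "(\<Sum>x\<in>S. f x) \<le> (\<Sum>x\<in>S. a * B + (if x \<in> ?T then B else 0))"
    using assms(2,3,4) by (intro sum_mono) (auto intro!: add_increasing)
  also have "\<dots> = a * B * card S + B * card ?T"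
    by (simp add: sum.distrib assms(1) flip: sum.inter_filter)
  finally have "B * (a * card S) \<le> B * card ?T" using assms(5) by (simp add: algebra_simps)
  then show ?thesis using assms(4) by simp
qed

text \<open>In a uniformly random \<open>x\<close>-subset of \<open>D\<close>, each element is
  present with probability \<open>x / card D\<close> and absent otherwise, both with probability at
  least 1/4. The expected distance to any fixed set is thus at least \<open>card D / 4\<close>, and
  \<open>reverse_markov\<close> applies with \<open>a = 1/8\<close>.\<close>

lemma subsets_far_from_set:
  assumes "finite D" "x \<le> card D" "card D \<le> 4 * x" "4 * x \<le> 3 * card D"
  shows "(card D choose x) / 8 \<le> card {X. X \<subseteq> D \<and> card X = x \<and> card D \<le> 8 * card (sym_diff X (Y \<inter> D))}"
proof (cases "card D = 0")
  \<comment> \<open>\<open>reverse_markov\<close> needs a positive upper bound, here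
    \<open>card D\<close>, so the empty set is treated apart.\<close>
  case True
  with assms have "D = {}" "x = 0" by auto
  moreover have "{X :: 'a set. X = {} \<and> card X = 0} = {{}}" by auto
  ultimately show ?thesis by (simp cong: conj_cong)
next
  case False
  let ?b = "card D" and ?S = "{X. X \<subseteq> D \<and> card X = x}"
  have finS: "finite ?S" using assms(1) by simp
  have x: "0 < x" "x < ?b" using False assms by linarith+
  have cS: "card ?S = ?b choose x" by (rule n_subsets[OF assms(1)])
  have notin: "4 * card {X \<in> ?S. j \<notin> X} \<ge> (?b choose x)" if "j \<in> D" for j
  proof -
    have "{X \<in> ?S. j \<notin> X} = {X. X \<subseteq> D - {j} \<and> card X = x}" by auto
    then have "card {X \<in> ?S. j \<notin> X} = (?b - 1) choose x"
      using that assms(1) by (simp add: n_subsets)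
    moreover have "(?b - x) * (?b choose x) = ?b * ((?b - 1) choose x)"
      using binomial_absorb_comp by simp
    moreover have "?b * (?b choose x) \<le> 4 * (?b - x) * (?b choose x)"
      using assms by (intro mult_right_mono) linarith+
    then have "?b * (?b choose x) \<le> 4 * ((?b - x) * (?b choose x))" by (simp only: mult.assoc)
    ultimately have "?b * (?b choose x) \<le> ?b * (4 * card {X \<in> ?S. j \<notin> X})"
      by (simp only: mult.left_commute)
    then show ?thesis using False by simp
  qed
  have isin: "4 * card {X \<in> ?S. j \<in> X} \<ge> (?b choose x)" if "j \<in> D" for j
  proof -
    \<comment> \<open>Counted as the complement of the sets avoiding \<open>j\<close>, followed by
      Pascal's rule.\<close>
    have "{X \<in> ?S. j \<in> X} = ?S - {X \<in> ?S. j \<notin> X}" by auto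
    then have "card {X \<in> ?S. j \<in> X} = card (?S - {X \<in> ?S. j \<notin> X})" by (rule arg_cong)
    also have "\<dots> = card ?S - card {X \<in> ?S. j \<notin> X}"
      by (rule card_Diff_subset) (auto intro: finite_subset[OF _ finS])
    finally have "card {X \<in> ?S. j \<in> X} = (?b choose x) - card {X \<in> ?S. j \<notin> X}"
      unfolding cS .
    moreover have "{X \<in> ?S. j \<notin> X} = {X. X \<subseteq> D - {j} \<and> card X = x}" by auto
    then have "card {X \<in> ?S. j \<notin> X} = (?b - 1) choose x"
      using that assms(1) by (simp add: n_subsets)
    moreover have "?b choose x = (?b - 1 choose x) + (?b - 1 choose (x - 1))"
      using x by (metis Suc_diff_1 add.commute binomial_Suc_Suc less_trans)
    ultimately have "card {X \<in> ?S. j \<in> X} = (?b - 1) choose (x - 1)" by linarith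
    moreover have "x * (?b choose x) = ?b * ((?b - 1) choose (x - 1))"
      using x binomial_absorption[of "x - 1" ?b] by simp
    moreover have "?b * (?b choose x) \<le> 4 * x * (?b choose x)"
      using assms by (intro mult_right_mono) linarith+
    then have "?b * (?b choose x) \<le> 4 * (x * (?b choose x))" by (simp only: mult.assoc)
    ultimately have "?b * (?b choose x) \<le> ?b * (4 * card {X \<in> ?S. j \<in> X})"
      by (simp only: mult.left_commute)
    then show ?thesis using False by simp
  qed
  have "(\<Sum>X\<in>?S. card (sym_diff X (Y \<inter> D))) = (\<Sum>X\<in>?S. \<Sum>j\<in>D. if j \<in> sym_diff X (Y \<inter> D) then 1 else 0)"
  proof (rule sum.cong[OF refl])
    fix X assume "X \<in> ?S"
    then have "sym_diff X (Y \<inter> D) = {j \<in> D. j \<in> sym_diff X (Y \<inter> D)}" by auto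
    then have "card (sym_diff X (Y \<inter> D)) = card {j \<in> D. j \<in> sym_diff X (Y \<inter> D)}" by (rule arg_cong)
    also have "\<dots> = (\<Sum>j\<in>D. if j \<in> sym_diff X (Y \<inter> D) then 1 else 0)"
      by (simp only: card_eq_sum sum.inter_filter[OF assms(1)])
    finally show "card (sym_diff X (Y \<inter> D)) = (\<Sum>j\<in>D. if j \<in> sym_diff X (Y \<inter> D) then 1 else 0)" .
  qed
  also have "\<dots> = (\<Sum>j\<in>D. card {X \<in> ?S. j \<in> sym_diff X (Y \<inter> D)})"
    by (subst sum.swap) (simp add: finS flip: sum.inter_filter)
  finally have sum: "(\<Sum>X\<in>?S. card (sym_diff X (Y \<inter> D))) = (\<Sum>j\<in>D. card {X \<in> ?S. j \<in> sym_diff X (Y \<inter> D)})" .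
  have "?b * (?b choose x) \<le> (\<Sum>j\<in>D. 4 * card {X \<in> ?S. j \<in> sym_diff X (Y \<inter> D)})"
  proof -
    have "(?b choose x) \<le> 4 * card {X \<in> ?S. j \<in> sym_diff X (Y \<inter> D)}" if "j \<in> D" for j
    proof (cases "j \<in> Y")
      case True
      then have "{X \<in> ?S. j \<in> sym_diff X (Y \<inter> D)} = {X \<in> ?S. j \<notin> X}" using that by auto
      then show ?thesis using notin[OF that] by simp
    next
      case False
      then have "{X \<in> ?S. j \<in> sym_diff X (Y \<inter> D)} = {X \<in> ?S. j \<in> X}" using that by auto
      then show ?thesis using isin[OF that] by simp
    qed
    then show ?thesis using sum_bounded_below[of D "?b choose x"] by simp
  qed
  then have "?b * card ?S \<le> 4 * (\<Sum>X\<in>?S. card (sym_diff X (Y \<inter> D)))"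
    unfolding sum cS by (simp add: sum_distrib_left)
  then have "real (?b * card ?S) \<le> real (4 * (\<Sum>X\<in>?S. card (sym_diff X (Y \<inter> D))))"
    by (simp only: of_nat_le_iff)
  then have ge: "2 * (1/8) * real ?b * card ?S \<le> (\<Sum>X\<in>?S. real (card (sym_diff X (Y \<inter> D))))"
    by simp
  have "1/8 * real (card ?S) \<le> card {X \<in> ?S. 1/8 * real ?b \<le> real (card (sym_diff X (Y \<inter> D)))}"
  proof (rule reverse_markov[OF finS _ _ _ ge])
    fix X assume "X \<in> ?S"
    then have "card (sym_diff X (Y \<inter> D)) \<le> ?b"
      by (intro card_mono assms(1)) auto
    then show "real (card (sym_diff X (Y \<inter> D))) \<le> real ?b" by simp
  qed (use False in auto)
  moreover have "{X \<in> ?S. 1/8 * real ?b \<le> real (card (sym_diff X (Y \<inter> D)))}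
     = {X. X \<subseteq> D \<and> card X = x \<and> ?b \<le> 8 * card (sym_diff X (Y \<inter> D))}"
    by (auto simp flip: of_nat_mult)
  ultimately show ?thesis by (simp add: cS)
qed

section \<open>Transfers between rows\<close>

text \<open>Resampling rows \<open>q\<close> and \<open>r\<close> leaves row \<open>p\<close> alone,
  while row \<open>q\<close> becomes random on the positions where it differed from
  \<open>r\<close>. It is then often far from row \<open>p\<close>, so a large difference between
  \<open>q\<close> and \<open>r\<close> passes to \<open>p\<close> and \<open>q\<close>.\<close>

lemma spread_transfer:
  fixes L b\<^sub>0 :: real
  assumes fin: "finite I" "finite J" and I: "p \<in> I" "q \<in> I" "r \<in> I" "q \<noteq> r" "p \<noteq> q" "p \<noteq> r"
    and L: "\<bar>real (s q) - real (s r)\<bar> \<le> L" "2 * L \<le> b\<^sub>0"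
  shows "1/8 * real (card {G \<in> margin_class I J s t. b\<^sub>0 \<le> card (row_diff q r G)})
           \<le> card {G \<in> margin_class I J s t. b\<^sub>0 / 8 \<le> card (row_diff p q G)}" (is "_ * real (card ?S) \<le> real (card ?T)")
proof (rule card_le_by_fibers[where k = "row_key q r"])
  fix G assume "G \<in> ?S"
  then have G: "G \<in> margin_class I J s t" and b: "b\<^sub>0 \<le> card (row_diff q r G)" by auto
  let ?D = "row_diff q r G" and ?C = "G `` {q} \<inter> G `` {r}" and ?Y = "G `` {p}"
  let ?b = "card ?D" and ?x = "s q - card ?C"
  note c = margin_class_row_diff[OF fin I(2,3) G]
  have finD: "finite ?D"
    using G by (auto intro!: finite_subset[OF _ fin(2)] simp: row_diff_def margin_class_def)
  have "2 * real (card ?C) + real ?b = real (s q) + real (s r)"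
    using c(2) by (simp flip: of_nat_add)
  then have x: "2 * real ?x - real ?b = real (s q) - real (s r)"
    using c(1) by (simp add: of_nat_diff)
  \<comment> \<open>Since \<open>L \<le> b\<^sub>0 / 2 \<le> ?b / 2\<close>, the size
    \<open>?x\<close> lies between a quarter and three quarters of \<open>?b\<close>.\<close>
  have "?b \<le> 4 * ?x" "4 * ?x \<le> 3 * ?b" "?x \<le> ?b"
    using x L b by linarith+
  then have main: "(?b choose ?x) / 8 \<le> card {X. X \<subseteq> ?D \<and> card X = ?x \<and> ?b \<le> 8 * card (sym_diff X (?Y \<inter> ?D))}"
    (is "_ \<le> real (card ?R)")
    by (intro subsets_far_from_set finD)
  have "card {H \<in> ?S. row_key q r H = row_key q r G}
      \<le> card {H \<in> margin_class I J s t. row_key q r H = row_key q r G}"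
    by (rule card_mono) (auto simp: finite_margin_class fin)
  also have "\<dots> = ?b choose ?x"
    by (rule card_row_key_fiber[of I J q r G s t s, OF fin I(2,3,4) G _ _ c(1)]) auto
  finally have "1/8 * real (card {H \<in> ?S. row_key q r H = row_key q r G}) \<le> card ?R"
    using main by simp
  also have "card ?R = card (reglue q r G ` ?R)"
    by (rule card_image[symmetric], rule inj_on_subset[OF inj_on_reglue[OF I(4)]]) auto
  also have "\<dots> \<le> card {H \<in> ?T. row_key q r H = row_key q r G}"
  proof (rule card_mono)
    show "reglue q r G ` ?R \<subseteq> {H \<in> ?T. row_key q r H = row_key q r G}"
    proof
      fix H assume "H \<in> reglue q r G ` ?R"
      then obtain X where X: "X \<subseteq> ?D" "card X = ?x" "?b \<le> 8 * card (sym_diff X (?Y \<inter> ?D))"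
        and H: "H = reglue q r G X" by auto
      have "H \<in> {H \<in> margin_class I J s t. row_key q r H = row_key q r G}"
        unfolding row_key_fiber[of I J q r G s t s, OF fin I(2,3,4) G refl refl]
        using X c(1) H by auto
      then have *: "H \<in> margin_class I J s t" "row_key q r H = row_key q r G" by auto
      \<comment> \<open>Inside \<open>?D\<close> the new row \<open>q\<close> is exactly
        \<open>X\<close>, since common positions lie outside \<open>?D\<close>, and row
        \<open>p\<close> is still \<open>?Y\<close>.\<close>
      have "sym_diff X (?Y \<inter> ?D) \<subseteq> row_diff p q H"
        using X(1) I unfolding H row_diff_def[of p q] row_reglue[OF I(4)] row_reglue(3)[OF I(4) I(5,6)]
        by (auto simp: row_diff_def)
      moreover have "finite (row_diff p q H)"
        using *(1) by (auto intro!: finite_subset[OF _ fin(2)] simp: row_diff_def margin_class_def)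
      ultimately have "card (sym_diff X (?Y \<inter> ?D)) \<le> card (row_diff p q H)" by (rule card_mono[rotated])
      then have "b\<^sub>0 / 8 \<le> card (row_diff p q H)" using X(3) b by linarith
      then show "H \<in> {H \<in> ?T. row_key q r H = row_key q r G}" using * by simp
    qed
  qed (simp add: finite_margin_class fin)
  finally show "1/8 * real (card {H \<in> ?S. row_key q r H = row_key q r G})
      \<le> real (card {H \<in> ?T. row_key q r H = row_key q r G})" by simp
qed (auto simp: finite_margin_class fin)

text \<open>Double counting by columns: in column \<open>j\<close>, the rows that disagree with row
  \<open>q\<close> number \<open>t j\<close> or \<open>card I - t j\<close>, and both are at least
  \<open>\<alpha> * card I\<close>.\<close>

lemma sum_card_row_diff:
  fixes \<alpha> :: real
  assumes fin: "finite I" "finite J" and q: "q \<in> I" and G: "G \<in> margin_class I J s t"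
    and t: "\<And>j. j \<in> J \<Longrightarrow> \<alpha> * card I \<le> t j \<and> t j \<le> (1 - \<alpha>) * card I"
  shows "\<alpha> * card I * card J \<le> (\<Sum>i\<in>I. real (card (row_diff q i G)))"
proof -
  have sub: "G \<subseteq> I \<times> J" using G by (auto simp: margin_class_def)
  have "(\<Sum>i\<in>I. real (card (row_diff q i G))) = (\<Sum>i\<in>I. \<Sum>j\<in>J. if j \<in> row_diff q i G then 1 else 0)"
  proof (rule sum.cong[OF refl])
    fix i
    have "row_diff q i G = {j \<in> J. j \<in> row_diff q i G}" using sub by (auto simp: row_diff_def)
    then have "card (row_diff q i G) = card {j \<in> J. j \<in> row_diff q i G}" by (rule arg_cong)
    then show "real (card (row_diff q i G)) = (\<Sum>j\<in>J. if j \<in> row_diff q i G then 1 else 0)"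
      using fin(2) by (simp flip: sum.inter_filter)
  qed
  also have "\<dots> = (\<Sum>j\<in>J. \<Sum>i\<in>I. if j \<in> row_diff q i G then 1 else 0)" by (rule sum.swap)
  also have "\<dots> = (\<Sum>j\<in>J. real (card {i \<in> I. j \<in> row_diff q i G}))"
    using fin(1) by (simp flip: sum.inter_filter)
  also have "\<dots> \<ge> (\<Sum>j\<in>J. \<alpha> * card I)"
  proof (rule sum_mono)
    fix j assume j: "j \<in> J"
    let ?T = "G\<inverse> `` {j}"
    have T: "?T \<subseteq> I" "card ?T = t j" using G j by (auto simp: margin_class_def)
    then have "finite ?T" using fin by (auto intro: finite_subset)
    show "\<alpha> * card I \<le> card {i \<in> I. j \<in> row_diff q i G}"
    proof (cases "(q, j) \<in> G")
      case True
      then have "{i \<in> I. j \<in> row_diff q i G} = I - ?T" by (auto simp: row_diff_def)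
      then have "card {i \<in> I. j \<in> row_diff q i G} = card I - t j"
        using T \<open>finite ?T\<close> by (simp add: card_Diff_subset)
      moreover have "t j \<le> card I" using T fin by (metis card_mono)
      ultimately show ?thesis using t[OF j] by (simp add: of_nat_diff algebra_simps)
    next
      case False
      then have "{i \<in> I. j \<in> row_diff q i G} = ?T" using T(1) by (auto simp: row_diff_def)
      then show ?thesis using T t[OF j] by simp
    qed
  qed
  finally show ?thesis by (simp add: mult_ac)
qed

text \<open>Averaging yields a third row \<open>r\<close> that often differs much from
  \<open>q\<close>, but says nothing about the prescribed row \<open>p\<close>;
  \<open>spread_transfer\<close> carries the difference over to the pair \<open>p\<close>,
  \<open>q\<close>.\<close>

lemma rows_spread:
  fixes \<alpha> w \<sigma> :: real
  assumes fin: "finite I" "finite J" and I: "p \<in> I" "q \<in> I" "p \<noteq> q"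
    and \<alpha>: "0 < \<alpha>" "2 \<le> \<alpha> * card I" "J \<noteq> {}"
    and t: "\<And>j. j \<in> J \<Longrightarrow> \<alpha> * card I \<le> t j \<and> t j \<le> (1 - \<alpha>) * card I"
    and s: "\<And>i. i \<in> I \<Longrightarrow> \<bar>real (s i) - \<sigma>\<bar> \<le> w" and w: "16 * w \<le> \<alpha> * card J"
  shows "\<alpha> / 32 * card (margin_class I J s t)
           \<le> card {G \<in> margin_class I J s t. \<alpha> * card J / 32 \<le> card (row_diff p q G)}"
proof (cases "margin_class I J s t = {}")
  case True
  then show ?thesis by simp
next
  case False
  let ?\<G> = "margin_class I J s t" and ?m = "card I" and ?n = "card J"
  have fG: "finite ?\<G>" by (rule finite_margin_class[OF fin])
  define B where "B = \<alpha> / 2 * ?n * card ?\<G>"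
  have n0: "0 < ?n" using fin \<alpha> by (simp add: card_gt_0_iff)
  have Bpos: "0 < B" using False fG n0 \<alpha> by (simp add: B_def card_gt_0_iff)
  \<comment> \<open>Dropping \<open>p\<close> and \<open>q\<close> loses at most \<open>?n\<close>,
    because row \<open>q\<close> does not differ from itself; by
    \<open>2 \<le> \<alpha> * card I\<close> this is at most half of the lower bound for the full
    sum.\<close>
  have one: "\<alpha> / 2 * ?m * ?n \<le> (\<Sum>i\<in>I - {p, q}. real (card (row_diff q i G)))" if G: "G \<in> ?\<G>" for G
  proof -
    have "\<alpha> * ?m * ?n \<le> (\<Sum>i\<in>I. real (card (row_diff q i G)))"
      by (rule sum_card_row_diff[OF fin I(2) G t])
    also have "\<dots> = (\<Sum>i\<in>I - {p, q}. real (card (row_diff q i G))) + (\<Sum>i\<in>{p, q}. real (card (row_diff q i G)))"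
      by (rule sum.subset_diff) (use I fin in auto)
    also have "(\<Sum>i\<in>{p, q}. real (card (row_diff q i G))) \<le> ?n"
      using I margin_class_row_diff(3)[OF fin I(2,1) G] by (simp add: row_diff_def)
    finally have "\<alpha> * ?m * ?n \<le> (\<Sum>i\<in>I - {p, q}. real (card (row_diff q i G))) + ?n" by simp
    moreover have "2 * real ?n \<le> \<alpha> * ?m * ?n" using \<alpha> by (intro mult_right_mono) auto
    ultimately show ?thesis by simp
  qed
  \<comment> \<open>The sum over the whole class is taken before choosing, so that one row
    \<open>r\<close> serves all matrices.\<close>
  have "\<exists>i\<in>I - {p, q}. B \<le> (\<Sum>G\<in>?\<G>. real (card (row_diff q i G)))"
  proof (rule ccontr)
    assume "\<not> ?thesis"
    then have "(\<Sum>i\<in>I - {p, q}. \<Sum>G\<in>?\<G>. real (card (row_diff q i G))) \<le> card (I - {p, q}) * B"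
      by (intro sum_bounded_above) (auto simp: not_le intro: less_imp_le)
    also have "\<dots> < ?m * B"
    proof (rule mult_strict_right_mono)
      have "card (I - {p, q}) < card I"
        by (rule psubset_card_mono) (use I fin in auto)
      then show "real (card (I - {p, q})) < ?m" by simp
    qed (rule Bpos)
    also have "\<dots> = (\<Sum>G\<in>?\<G>. \<alpha> / 2 * ?m * ?n)" by (simp add: B_def)
    also have "\<dots> \<le> (\<Sum>G\<in>?\<G>. \<Sum>i\<in>I - {p, q}. real (card (row_diff q i G)))"
      by (rule sum_mono) (rule one)
    also have "\<dots> = (\<Sum>i\<in>I - {p, q}. \<Sum>G\<in>?\<G>. real (card (row_diff q i G)))" by (rule sum.swap)
    finally show False by simp
  qed
  then obtain r where r: "r \<in> I" "r \<noteq> p" "r \<noteq> q" and sumr: "B \<le> (\<Sum>G\<in>?\<G>. real (card (row_diff q r G)))"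
    by auto
  \<comment> \<open>\<open>reverse_markov\<close> with \<open>a = \<alpha> / 4\<close>;
    \<open>spread_transfer\<close> then divides both the proportion and the threshold by 8.\<close>
  have "\<alpha> / 4 * card ?\<G> \<le> card {G \<in> ?\<G>. \<alpha> / 4 * ?n \<le> card (row_diff q r G)}"
  proof (rule reverse_markov[OF fG])
    show "2 * (\<alpha> / 4) * ?n * card ?\<G> \<le> (\<Sum>G\<in>?\<G>. real (card (row_diff q r G)))"
      using sumr by (simp add: B_def)
    show "real (card (row_diff q r G)) \<le> ?n" if "G \<in> ?\<G>" for G
      using margin_class_row_diff(3)[OF fin I(2) r(1) that] by simp
  qed (use \<alpha> n0 in auto)
  then have "\<alpha> / 32 * card ?\<G> \<le> 1/8 * real (card {G \<in> ?\<G>. \<alpha> / 4 * ?n \<le> card (row_diff q r G)})" by simp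
  also have "\<dots> \<le> card {G \<in> ?\<G>. \<alpha> / 4 * ?n / 8 \<le> card (row_diff p q G)}"
  proof (rule spread_transfer[OF fin I(1,2) r(1), where L = "2 * w"])
    show "\<bar>real (s q) - real (s r)\<bar> \<le> 2 * w" using s[OF I(2)] s[OF r(1)] by linarith
  qed (use r I w in auto)
  finally show ?thesis by simp
qed

text \<open>A lower bound for the factor lost in one transfer: \<open>\<alpha> / 32\<close> is the
  guaranteed proportion of matrices with spread rows, and the exponential is
  \<open>exp (- (4 * L\<^sup>2 / b))\<close> from \<open>binomial_ratio\<close> at
  \<open>L = 2 * w\<close> and \<open>b = \<alpha> * n / 32\<close>.\<close>

definition move_cost :: "real \<Rightarrow> real \<Rightarrow> nat \<Rightarrow> real" where
  "move_cost \<alpha> w n = \<alpha> / 32 * exp (- (512 * w\<^sup>2 / (\<alpha> * n)))"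

text \<open>Two row sums differ by at most \<open>L = 2 * w\<close>, and
  \<open>256 * w \<le> \<alpha> * card J\<close> is exactly \<open>4 * L \<le> b\<^sub>0\<close> for
  \<open>b\<^sub>0 = \<alpha> * card J / 32\<close>.\<close>

lemma row_pair_move:
  fixes \<alpha> w \<sigma> :: real
  assumes fin: "finite I" "finite J" and I: "p \<in> I" "q \<in> I" "p \<noteq> q"
    and \<alpha>: "0 < \<alpha>" "2 \<le> \<alpha> * card I" "J \<noteq> {}"
    and t: "\<And>j. j \<in> J \<Longrightarrow> \<alpha> * card I \<le> t j \<and> t j \<le> (1 - \<alpha>) * card I"
    and s: "\<And>i. i \<in> I \<Longrightarrow> \<bar>real (s i) - \<sigma>\<bar> \<le> w" and w: "256 * w \<le> \<alpha> * card J"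
    and s': "\<And>i. i \<in> I \<Longrightarrow> i \<noteq> p \<Longrightarrow> i \<noteq> q \<Longrightarrow> s' i = s i" "s' p + s' q = s p + s q"
      "\<bar>real (s' p) - \<sigma>\<bar> \<le> w" "\<bar>real (s' q) - \<sigma>\<bar> \<le> w"
  shows "move_cost \<alpha> w (card J) * card (margin_class I J s t) \<le> card (margin_class I J s' t)"
proof -
  let ?n = "card J" and ?\<G> = "margin_class I J s t"
  have n0: "0 < ?n" using fin \<alpha> by (simp add: card_gt_0_iff)
  have w0: "0 \<le> w" using s'(3) by linarith
  have e: "4 * (2 * w)\<^sup>2 / (\<alpha> * ?n / 32) = 512 * w\<^sup>2 / (\<alpha> * ?n)"
    using \<alpha> n0 by (simp add: field_simps power2_eq_square)
  have "move_cost \<alpha> w ?n * card ?\<G> = exp (- (4 * (2 * w)\<^sup>2 / (\<alpha> * ?n / 32))) * (\<alpha> / 32 * card ?\<G>)"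
    unfolding e by (simp add: move_cost_def)
  also have "\<dots> \<le> exp (- (4 * (2 * w)\<^sup>2 / (\<alpha> * ?n / 32)))
      * card {G \<in> ?\<G>. \<alpha> * ?n / 32 \<le> card (row_diff p q G)}"
    by (intro mult_left_mono rows_spread[OF fin I \<alpha> t s]) (use w w0 in auto)
  also have "\<dots> \<le> card (margin_class I J s' t)"
  proof (rule move_from_spread_rows[OF fin I s'(1,2)])
    show "\<bar>real (s p) - real (s q)\<bar> \<le> 2 * w" using s[OF I(1)] s[OF I(2)] by linarith
    show "\<bar>real (s' p) - real (s' q)\<bar> \<le> 2 * w" using s'(3,4) by linarith
  qed (use w \<alpha> n0 in auto)
  finally show ?thesis .
qed

text \<open>Each transfer brings at least one row sum to its target and never moves a sum away from
  its own, so all sums stay in the window and at most \<open>card I\<close> transfers are needed.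
  Column sums never change, which keeps the condition on \<open>t\<close> valid throughout.\<close>

lemma rows_move:
  fixes \<alpha> w \<sigma> :: real
  assumes fin: "finite I" "finite J" and \<alpha>: "0 < \<alpha>" "\<alpha> \<le> 1" "2 \<le> \<alpha> * card I" "J \<noteq> {}"
    and t: "\<And>j. j \<in> J \<Longrightarrow> \<alpha> * card I \<le> t j \<and> t j \<le> (1 - \<alpha>) * card I"
    and w: "256 * w \<le> \<alpha> * card J"
    and s': "\<And>i. i \<in> I \<Longrightarrow> \<bar>real (s' i) - \<sigma>\<bar> \<le> w"
    and s: "\<And>i. i \<in> I \<Longrightarrow> \<bar>real (s i) - \<sigma>\<bar> \<le> w"
    and sum: "(\<Sum>i\<in>I. s i) = (\<Sum>i\<in>I. s' i)"
  shows "move_cost \<alpha> w (card J) ^ card I * card (margin_class I J s t) \<le> card (margin_class I J s' t)"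
proof -
  let ?\<kappa> = "move_cost \<alpha> w (card J)"
  have "exp (- (512 * w\<^sup>2 / (\<alpha> * card J))) \<le> 1" using \<alpha> by simp
  then have \<kappa>: "0 \<le> ?\<kappa>" "?\<kappa> \<le> 1"
    using \<alpha> mult_mono[of "\<alpha> / 32" 1 "exp (- (512 * w\<^sup>2 / (\<alpha> * card J)))" 1] by (auto simp: move_cost_def)
  have "?\<kappa> ^ card {i \<in> I. s i \<noteq> s' i} * card (margin_class I J s t) \<le> card (margin_class I J s' t)"
    using s sum
  proof (induction "card {i \<in> I. s i \<noteq> s' i}" arbitrary: s rule: less_induct)
    case less
    show ?case
    proof (cases "\<forall>i\<in>I. s i = s' i")
      case True
      then have "margin_class I J s t = margin_class I J s' t" "{i \<in> I. s i \<noteq> s' i} = {}"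
        by (auto simp: margin_class_def)
      then show ?thesis by (metis card.empty lambda_one order_refl power_0)
    next
      case False
      have "\<exists>p\<in>I. s' p < s p"
      proof (rule ccontr)
        assume "\<not> ?thesis"
        then have le: "\<And>i. i \<in> I \<Longrightarrow> s i \<le> s' i" by (auto simp: not_less)
        with False have "(\<Sum>i\<in>I. s i) < (\<Sum>i\<in>I. s' i)"
          by (intro sum_strict_mono_ex1 fin) (auto simp: order_less_le)
        with less.prems(2) show False by simp
      qed
      then obtain p where p: "p \<in> I" "s' p < s p" by auto
      have "\<exists>q\<in>I. s q < s' q"
      proof (rule ccontr)
        assume "\<not> ?thesis"
        then have le: "\<And>i. i \<in> I \<Longrightarrow> s' i \<le> s i" by (auto simp: not_less)
        with p have "(\<Sum>i\<in>I. s' i) < (\<Sum>i\<in>I. s i)"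
          by (intro sum_strict_mono_ex1 fin) auto
        with less.prems(2) show False by simp
      qed
      then obtain q where q: "q \<in> I" "s q < s' q" by auto
      \<comment> \<open>The largest amount that overshoots neither target; one of the two rows
        reaches its target exactly.\<close>
      define d where "d = min (s p - s' p) (s' q - s q)"
      define s1 where "s1 = s(p := s p - d, q := s q + d)"
      have pq: "p \<noteq> q" using p q by auto
      have d: "d \<le> s p - s' p" "d \<le> s' q - s q" "d = s p - s' p \<or> d = s' q - s q"
        by (auto simp: d_def)
      have s1: "s1 p = s p - d" "s1 q = s q + d" "\<And>i. i \<noteq> p \<Longrightarrow> i \<noteq> q \<Longrightarrow> s1 i = s i"
        using pq by (auto simp: s1_def)
      have b: "s' p \<le> s1 p" "s1 p \<le> s p" "s q \<le> s1 q" "s1 q \<le> s' q" "s1 p + s1 q = s p + s q"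
        using s1 d p q by auto
      have w1: "\<bar>real (s1 p) - \<sigma>\<bar> \<le> w" "\<bar>real (s1 q) - \<sigma>\<bar> \<le> w"
        using b s'[OF p(1)] s'[OF q(1)] less.prems(1)[OF p(1)] less.prems(1)[OF q(1)] by linarith+
      have step: "?\<kappa> * card (margin_class I J s t) \<le> card (margin_class I J s1 t)"
        by (rule row_pair_move[OF fin p(1) q(1) pq \<alpha>(1,3,4) t less.prems(1) w _ b(5) w1])
          (use s1(3) in auto)
      have sub: "{i \<in> I. s1 i \<noteq> s' i} \<subset> {i \<in> I. s i \<noteq> s' i}"
      proof -
        have "{i \<in> I. s1 i \<noteq> s' i} \<subseteq> {i \<in> I. s i \<noteq> s' i}"
        proof clarify
          fix i assume "s1 i \<noteq> s' i" "s i = s' i"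
          then show False using p(2) q(2) s1(3)[of i] by (cases "i = p"; cases "i = q") auto
        qed
        moreover have "s1 p = s' p \<or> s1 q = s' q" using d s1 p q by auto
        ultimately show ?thesis using p q by (metis (mono_tags, lifting) mem_Collect_eq nat_neq_iff psubsetI)
      qed
      then have lt: "card {i \<in> I. s1 i \<noteq> s' i} < card {i \<in> I. s i \<noteq> s' i}"
        by (rule psubset_card_mono[rotated]) (use fin in auto)
      have sum1: "(\<Sum>i\<in>I. s1 i) = (\<Sum>i\<in>I. s' i)"
      proof -
        have "(\<Sum>i\<in>I. f i) = f p + f q + (\<Sum>i\<in>I - {p, q}. f i)" for f :: "_ \<Rightarrow> nat"
          using pq p(1) q(1) fin(1) sum.subset_diff[of "{p, q}" I f] by simp
        moreover have "(\<Sum>i\<in>I - {p, q}. s1 i) = (\<Sum>i\<in>I - {p, q}. s i)"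
          by (rule sum.cong) (auto simp: s1(3))
        ultimately show ?thesis using b(5) less.prems(2) by metis
      qed
      have IH: "?\<kappa> ^ card {i \<in> I. s1 i \<noteq> s' i} * card (margin_class I J s1 t) \<le> card (margin_class I J s' t)"
      proof (rule less.hyps[OF lt _ sum1])
        show "\<bar>real (s1 i) - \<sigma>\<bar> \<le> w" if "i \<in> I" for i
          using less.prems(1)[OF that] w1 s1(3)[of i] by (cases "i = p"; cases "i = q") auto
      qed
      \<comment> \<open>As \<open>?\<kappa> \<le> 1\<close>, the strict drop in the number of wrong
        rows pays for the factor of this transfer.\<close>
      have "?\<kappa> ^ card {i \<in> I. s i \<noteq> s' i} \<le> ?\<kappa> ^ Suc (card {i \<in> I. s1 i \<noteq> s' i})"
        by (rule power_decreasing) (use lt \<kappa> in auto)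
      then have "?\<kappa> ^ card {i \<in> I. s i \<noteq> s' i} * card (margin_class I J s t)
          \<le> ?\<kappa> ^ card {i \<in> I. s1 i \<noteq> s' i} * (?\<kappa> * card (margin_class I J s t))"
        using mult_right_mono[of _ _ "real (card (margin_class I J s t))"] by (fastforce simp: mult_ac)
      also have "\<dots> \<le> ?\<kappa> ^ card {i \<in> I. s1 i \<noteq> s' i} * card (margin_class I J s1 t)"
        by (rule mult_left_mono[OF step]) (use \<kappa> in auto)
      also note IH
      finally show ?thesis .
    qed
  qed
  moreover have "?\<kappa> ^ card I \<le> ?\<kappa> ^ card {i \<in> I. s i \<noteq> s' i}"
    by (rule power_decreasing) (use \<kappa> fin in \<open>auto intro: card_mono\<close>)
  then have "?\<kappa> ^ card I * card (margin_class I J s t)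
      \<le> ?\<kappa> ^ card {i \<in> I. s i \<noteq> s' i} * card (margin_class I J s t)"
    by (rule mult_right_mono) simp
  ultimately show ?thesis by linarith
qed

text \<open>This makes the row transfers available for columns.\<close>

lemma card_margin_class_transpose: "card (margin_class J I t s) = card (margin_class I J s t)"
proof -
  have "margin_class J I t s = converse ` margin_class I J s t"
  proof
    show "margin_class J I t s \<subseteq> converse ` margin_class I J s t"
    proof
      fix G assume "G \<in> margin_class J I t s"
      then have "G\<inverse> \<in> margin_class I J s t" by (auto simp: margin_class_def)
      then show "G \<in> converse ` margin_class I J s t" by (metis converse_converse imageI)
    qed
  qed (auto simp: margin_class_def)
  then show ?thesis by (simp add: card_image inj_on_def)
qed

section \<open>The binomial model\<close>

text \<open>The probability of \<open>G\<close> when each element of \<open>S\<close> is chosen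
  independently with probability \<open>l\<close>; probabilities of events are finite sums of
  weights.\<close>

definition binomial_weight :: "real \<Rightarrow> 'a set \<Rightarrow> 'a set \<Rightarrow> real" where
  "binomial_weight l S G = l ^ card G * (1 - l) ^ (card S - card G)"

text \<open>For negative \<open>h\<close>,
  \<open>(1 + h + h\<^sup>2) * (1 - h) = 1 - h ^ 3 \<ge> 1\<close> and
  \<open>1 - h \<le> exp (- h)\<close>.\<close>

lemma exp_le_quadratic:
  fixes h :: real
  assumes "\<bar>h\<bar> \<le> 1"
  shows "exp h \<le> 1 + h + h\<^sup>2"
proof (cases "h \<ge> 0")
  case True
  then show ?thesis using exp_bound[of h] assms by simp
next
  case False
  have "1 \<le> (1 + h + h\<^sup>2) * (1 - h)"
  proof -
    have "(1 + h + h\<^sup>2) * (1 - h) = 1 + (- h) ^ 3" by (simp add: algebra_simps power2_eq_square power3_eq_cube)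
    moreover have "0 \<le> (- h) ^ 3" using False by (intro zero_le_power) auto
    ultimately show ?thesis by simp
  qed
  also have "\<dots> \<le> (1 + h + h\<^sup>2) * exp (- h)"
    using exp_ge_add_one_self[of "- h"] False assms by (intro mult_left_mono) auto
  finally show ?thesis by (simp add: exp_minus field_simps)
qed

text \<open>A product over cells is expanded into a sum over subsets; cells outside \<open>T\<close>
  contribute the factor \<open>l + (1 - l) = 1\<close>.\<close>

lemma binomial_weight_mgf:
  fixes l h :: real
  assumes "finite S" "T \<subseteq> S"
  shows "(\<Sum>G\<in>Pow S. binomial_weight l S G * exp (h * card (G \<inter> T))) = (1 - l + l * exp h) ^ card T"
proof -
  have "binomial_weight l S G * exp (h * card (G \<inter> T))
      = (\<Prod>e\<in>G. if e \<in> T then l * exp h else l) * (\<Prod>e\<in>S - G. 1 - l)" if "G \<in> Pow S" for G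
  proof -
    have fin: "finite G" using that assms(1) finite_subset by auto
    have "(\<Prod>e\<in>G. if e \<in> T then l * exp h else l) = (\<Prod>e\<in>G. l * (if e \<in> T then exp h else 1))"
      by (rule prod.cong) auto
    also have "\<dots> = l ^ card G * (\<Prod>e\<in>G. if e \<in> T then exp h else 1)"
      by (simp add: prod.distrib)
    also have "(\<Prod>e\<in>G. if e \<in> T then exp h else 1) = exp h ^ card (G \<inter> T)"
      using fin by (simp add: prod.If_cases Int_def)
    finally show ?thesis
      using that fin assms(1) by (simp add: binomial_weight_def card_Diff_subset mult_ac flip: exp_of_nat_mult)
  qed
  then have "(\<Sum>G\<in>Pow S. binomial_weight l S G * exp (h * card (G \<inter> T)))
      = (\<Sum>G\<in>Pow S. (\<Prod>e\<in>G. if e \<in> T then l * exp h else l) * (\<Prod>e\<in>S - G. 1 - l))"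
    by (rule sum.cong[OF refl])
  also have "\<dots> = (\<Prod>e\<in>S. (if e \<in> T then l * exp h else l) + (1 - l))"
    by (rule prod_add[symmetric]) (rule assms)
  also have "\<dots> = (\<Prod>e\<in>S. if e \<in> T then 1 - l + l * exp h else 1)"
    by (rule prod.cong) auto
  also have "\<dots> = (1 - l + l * exp h) ^ card T"
    using assms by (simp add: prod.If_cases Int_absorb1)
  finally show ?thesis .
qed

lemma binomial_weight_nonneg: "0 \<le> l \<Longrightarrow> l \<le> 1 \<Longrightarrow> 0 \<le> binomial_weight l S G"
  by (simp add: binomial_weight_def)

text \<open>Markov's inequality for the exponential moment. The sign of \<open>h\<close> selects the
  tail, and \<open>N\<close> may exceed \<open>card T\<close>, so that one bound serves many sets
  \<open>T\<close>.\<close>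

lemma chernoff_one_sided:
  fixes l h D :: real
  assumes "finite S" "T \<subseteq> S" "0 \<le> l" "l \<le> 1" "card T \<le> N" "\<bar>h\<bar> \<le> 1"
  shows "(\<Sum>G\<in>{G \<in> Pow S. D \<le> h * (card (G \<inter> T) - l * card T)}. binomial_weight l S G) \<le> exp (h\<^sup>2 * N - D)"
proof -
  have "(\<Sum>G\<in>{G \<in> Pow S. D \<le> h * (card (G \<inter> T) - l * card T)}. binomial_weight l S G)
      \<le> (\<Sum>G\<in>{G \<in> Pow S. D \<le> h * (card (G \<inter> T) - l * card T)}.
           binomial_weight l S G * exp (h * card (G \<inter> T)) * exp (- h * l * card T - D))"
  proof (rule sum_mono)
    fix G assume "G \<in> {G \<in> Pow S. D \<le> h * (card (G \<inter> T) - l * card T)}"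
    then have "1 \<le> exp (h * card (G \<inter> T) + (- h * l * card T - D))"
      by (simp add: algebra_simps)
    then have "binomial_weight l S G * 1 \<le> binomial_weight l S G * exp (h * card (G \<inter> T) + (- h * l * card T - D))"
      by (intro mult_left_mono binomial_weight_nonneg assms)
    then show "binomial_weight l S G \<le> binomial_weight l S G * exp (h * card (G \<inter> T)) * exp (- h * l * card T - D)"
      by (simp add: exp_add mult.assoc)
  qed
  also have "\<dots> \<le> (\<Sum>G\<in>Pow S. binomial_weight l S G * exp (h * card (G \<inter> T)) * exp (- h * l * card T - D))"
    by (rule sum_mono2) (auto simp: assms binomial_weight_nonneg)
  also have "\<dots> = (1 - l + l * exp h) ^ card T * exp (- h * l * card T - D)"
    unfolding sum_distrib_right[symmetric] binomial_weight_mgf[OF assms(1,2)] ..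
  also have "\<dots> \<le> exp (l * (h + h\<^sup>2)) ^ card T * exp (- h * l * card T - D)"
  proof (intro mult_right_mono power_mono)
    have "l * exp h \<le> l * (1 + h + h\<^sup>2)"
      by (intro mult_left_mono exp_le_quadratic assms)
    then have "1 - l + l * exp h \<le> 1 + l * (h + h\<^sup>2)" by (simp add: algebra_simps)
    also have "\<dots> \<le> exp (l * (h + h\<^sup>2))" by (rule exp_ge_add_one_self)
    finally show "1 - l + l * exp h \<le> exp (l * (h + h\<^sup>2))" .
  qed (use assms in auto)
  also have "\<dots> = exp (l * h\<^sup>2 * card T - D)"
    by (simp add: algebra_simps flip: exp_of_nat_mult exp_add)
  also have "\<dots> \<le> exp (h\<^sup>2 * N - D)"
  proof -
    have "l * card T \<le> 1 * real N" using assms by (intro mult_mono) auto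
    then have "h\<^sup>2 * (l * card T) \<le> h\<^sup>2 * N" by (intro mult_left_mono) auto
    then show ?thesis by (simp add: mult_ac)
  qed
  finally show ?thesis .
qed

lemma chernoff:
  fixes l x :: real
  assumes "finite S" "T \<subseteq> S" "0 \<le> l" "l \<le> 1" "card T \<le> N" "0 < N" "0 \<le> x" "x \<le> 2 * N"
  shows "(\<Sum>G\<in>{G \<in> Pow S. x \<le> \<bar>card (G \<inter> T) - l * card T\<bar>}. binomial_weight l S G) \<le> 2 * exp (- (x\<^sup>2 / (4 * real N)))"
proof -
  \<comment> \<open>This minimises \<open>h\<^sup>2 * N - h * x\<close>; the assumption
    \<open>x \<le> 2 * N\<close> keeps \<open>h \<le> 1\<close>.\<close>
  define h where "h = x / (2 * real N)"
  have h: "0 \<le> h" "h \<le> 1" using assms by (auto simp: h_def field_simps)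
  let ?A = "\<lambda>h. {G \<in> Pow S. \<bar>h\<bar> * x \<le> h * (card (G \<inter> T) - l * card T)}"
  have *: "(\<Sum>G\<in>?A h'. binomial_weight l S G) \<le> exp (- (x\<^sup>2 / (4 * real N)))" if "\<bar>h'\<bar> = h" for h'
  proof -
    have "(\<Sum>G\<in>?A h'. binomial_weight l S G) \<le> exp (h'\<^sup>2 * N - \<bar>h'\<bar> * x)"
      by (rule chernoff_one_sided) (use assms that h in auto)
    also have "h'\<^sup>2 * N - \<bar>h'\<bar> * x = h\<^sup>2 * N - h * x" using that by (metis power2_abs)
    also have "\<dots> = - (x\<^sup>2 / (4 * real N))" using assms by (simp add: h_def field_simps power2_eq_square)
    finally show ?thesis .
  qed
  have "{G \<in> Pow S. x \<le> \<bar>card (G \<inter> T) - l * card T\<bar>} \<subseteq> ?A h \<union> ?A (- h)"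
  proof
    fix G assume "G \<in> {G \<in> Pow S. x \<le> \<bar>card (G \<inter> T) - l * card T\<bar>}"
    then have G: "x \<le> \<bar>card (G \<inter> T) - l * card T\<bar>" "G \<subseteq> S" by auto
    show "G \<in> ?A h \<union> ?A (- h)"
    proof (cases "x \<le> card (G \<inter> T) - l * card T")
      case True
      then have "G \<in> ?A h" using G(2) h by (auto intro: mult_left_mono)
      then show ?thesis by blast
    next
      case False
      then have "x \<le> - (card (G \<inter> T) - l * card T)" using G(1) by linarith
      then have "h * x \<le> h * (- (card (G \<inter> T) - l * card T))" by (rule mult_left_mono) (rule h)
      then have "G \<in> ?A (- h)" using G(2) h by (simp add: algebra_simps)
      then show ?thesis by blast
    qed
  qed
  then have "(\<Sum>G\<in>{G \<in> Pow S. x \<le> \<bar>card (G \<inter> T) - l * card T\<bar>}. binomial_weight l S G)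
      \<le> (\<Sum>G\<in>?A h \<union> ?A (- h). binomial_weight l S G)"
    by (intro sum_mono2) (auto simp: assms binomial_weight_nonneg)
  also have "\<dots> \<le> (\<Sum>G\<in>?A h. binomial_weight l S G) + (\<Sum>G\<in>?A (- h). binomial_weight l S G)"
    using assms by (subst sum_Un) (auto intro!: sum_nonneg binomial_weight_nonneg)
  also have "\<dots> \<le> 2 * exp (- (x\<^sup>2 / (4 * real N)))"
    using *[of h] *[of "- h"] h by simp
  finally show ?thesis .
qed

text \<open>The terms rise up to \<open>M\<close> and fall afterwards, so the largest of these
  \<open>N + 1\<close> numbers with sum 1 is the one at \<open>M\<close>.\<close>

lemma binomial_mode:
  fixes l :: real
  assumes l: "0 \<le> l" "l < 1" and M: "real M = l * N"
  shows "1 / (real N + 1) \<le> (N choose M) * l ^ M * (1 - l) ^ (N - M)"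
proof -
  define b where "b k = (N choose k) * l ^ k * (1 - l) ^ (N - k)" for k
  have b0: "0 \<le> b k" for k using l by (simp add: b_def)
  have "l * N \<le> 1 * real N" using l by (intro mult_right_mono) auto
  then have MN: "M \<le> N" using M by simp
  \<comment> \<open>The ratio of consecutive terms with denominators cleared; it is compared with 1
    on either side of \<open>M\<close>.\<close>
  have step: "b (Suc k) * ((real k + 1) * (1 - l)) = b k * ((real N - real k) * l)" if "k < N" for k
  proof -
    have "Suc k * (N choose Suc k) = (N - k) * (N choose k)"
      by (metis binomial_absorb_comp binomial_absorption)
    then have "real (Suc k) * real (N choose Suc k) = (real N - real k) * real (N choose k)"
      using that by (metis less_imp_le_nat of_nat_diff of_nat_mult)
    then have c: "(real k + 1) * real (N choose Suc k) = (real N - real k) * real (N choose k)"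
      by (simp add: add.commute)
    have p: "(1 - l) ^ (N - k) = (1 - l) * (1 - l) ^ (N - Suc k)"
      using that by (metis Suc_diff_Suc power_Suc)
    have "b (Suc k) * ((real k + 1) * (1 - l))
        = ((real k + 1) * real (N choose Suc k)) * l * l ^ k * ((1 - l) * (1 - l) ^ (N - Suc k))"
      by (simp add: b_def)
    also have "\<dots> = b k * ((real N - real k) * l)"
      unfolding c by (simp add: b_def p)
    finally show ?thesis .
  qed
  have up: "b k \<le> b (Suc k)" if "k < M" for k
  proof -
    have "real k + 1 \<le> real M" using that by linarith
    then have "(real k + 1) * (1 - l) \<le> (real N - real k) * l" using M l by (simp add: algebra_simps)
    then have "b k * ((real k + 1) * (1 - l)) \<le> b (Suc k) * ((real k + 1) * (1 - l))"
      using step[of k] that MN b0[of k] by (simp add: mult_left_mono)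
    then show ?thesis by (rule mult_right_le_imp_le) (use l in simp)
  qed
  have down: "b (Suc k) \<le> b k" if "M \<le> k" "k < N" for k
  proof -
    have "real M \<le> real k" using that by simp
    then have "(real N - real k) * l \<le> (real k + 1) * (1 - l)" using M l by (simp add: algebra_simps)
    then have "b (Suc k) * ((real k + 1) * (1 - l)) \<le> b k * ((real k + 1) * (1 - l))"
      using step[of k] that b0[of k] by (simp add: mult_left_mono)
    then show ?thesis by (rule mult_right_le_imp_le) (use l in simp)
  qed
  have "b k \<le> b M" if "k \<le> N" for k
  proof (cases "k \<le> M")
    case True
    then show ?thesis by (induction rule: inc_induct) (auto intro: order_trans up)
  next
    case False
    then have "M \<le> k" by simp
    then show ?thesis using that by (induction rule: dec_induct) (auto simp: Suc_le_eq intro: order_trans[OF down])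
  qed
  then have "(\<Sum>k\<le>N. b k) \<le> (\<Sum>k\<le>N. b M)" by (intro sum_mono) auto
  moreover have "(\<Sum>k\<le>N. b k) = 1"
    using binomial_ring[of l "1 - l" N] by (simp add: b_def)
  ultimately show ?thesis by (simp add: b_def field_simps)
qed

section \<open>Margins of positive probability in the binomial model\<close>

lemma card_eq_sum_rows:
  assumes "finite I" "finite J" "G \<subseteq> I \<times> J"
  shows "card G = (\<Sum>i\<in>I. card (G `` {i}))"
proof -
  have "G = (SIGMA i:I. G `` {i})" using assms(3) by auto
  then have "card G = card (SIGMA i:I. G `` {i})" by (rule arg_cong)
  also have "\<dots> = (\<Sum>i\<in>I. card (G `` {i}))"
    by (rule card_SigmaI) (use assms in \<open>auto intro: finite_subset\<close>)
  finally show ?thesis .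
qed

lemma card_eq_sum_cols:
  assumes "finite I" "finite J" "G \<subseteq> I \<times> J"
  shows "card G = (\<Sum>j\<in>J. card (G\<inverse> `` {j}))"
  using card_eq_sum_rows[of J I "G\<inverse>"] assms by auto

lemma margin_class_card:
  assumes "finite I" "finite J" "G \<in> margin_class I J s t"
  shows "card G = (\<Sum>i\<in>I. s i)"
  using assms card_eq_sum_rows[of I J G] by (auto simp: margin_class_def)

text \<open>The weight depends only on the number of ones, so the binomial model conditioned on the
  margins is uniform.\<close>

lemma binomial_weight_margin_class:
  assumes "finite I" "finite J" "(\<Sum>i\<in>I. s i) = M" "G \<in> margin_class I J s t"
  shows "binomial_weight l (I \<times> J) G = l ^ M * (1 - l) ^ (card I * card J - M)"
  using assms margin_class_card[OF assms(1,2,4)] by (simp add: binomial_weight_def card_cartesian_product)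

text \<open>Otherwise every fiber is below the average \<open>card S / card R\<close>, and the at
  most \<open>card R\<close> nonempty fibers cannot exhaust \<open>S\<close>.\<close>

lemma pigeonhole_fiber:
  assumes "finite S" "S \<noteq> {}" "finite R" "k ` S \<subseteq> R"
  shows "\<exists>x\<in>S. card S \<le> card R * card {y \<in> S. k y = k x}"
proof (rule ccontr)
  assume *: "\<not> ?thesis"
  have "card S = (\<Sum>z\<in>k ` S. card {y \<in> S. k y = z})"
    using sum.image_gen[OF assms(1), of "\<lambda>_. 1 :: nat" k] by simp
  then have "card R * card S = (\<Sum>z\<in>k ` S. card R * card {y \<in> S. k y = z})"
    by (simp add: sum_distrib_left)
  also have "\<dots> < (\<Sum>z\<in>k ` S. card S)"
    by (rule sum_strict_mono) (use * assms in auto)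
  also have "\<dots> = card (k ` S) * card S" by simp
  also have "\<dots> \<le> card R * card S" by (intro mult_right_mono card_mono assms) auto
  finally show False by simp
qed

lemma sum_Un_le:
  fixes f :: "'a \<Rightarrow> real"
  assumes "finite A" "finite B" "\<And>x. 0 \<le> f x"
  shows "sum f (A \<union> B) \<le> sum f A + sum f B"
  using assms by (subst sum_Un) (auto intro: sum_nonneg)

lemma sum_UN_le:
  fixes f :: "'a \<Rightarrow> real"
  assumes "finite I" "\<And>i. finite (A i)" "\<And>x. 0 \<le> f x"
  shows "sum f (\<Union>i\<in>I. A i) \<le> (\<Sum>i\<in>I. sum f (A i))"
  using assms(1)
proof induction
  case empty
  then show ?case by simp
next
  case (insert i I)
  have "sum f (A i \<union> (\<Union>i\<in>I. A i)) \<le> sum f (A i) + sum f (\<Union>i\<in>I. A i)"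
    by (rule sum_Un_le) (use insert assms in auto)
  then show ?case using insert by simp
qed

text \<open>The inequalities are strict because each violation is then a closed tail event as in
  \<open>chernoff\<close>.\<close>

definition balanced :: "'a set \<Rightarrow> 'b set \<Rightarrow> real \<Rightarrow> real \<Rightarrow> real \<Rightarrow> ('a \<times> 'b) set \<Rightarrow> bool" where
  "balanced I J l u v G \<longleftrightarrow>
     (\<forall>i\<in>I. \<bar>real (card (G `` {i})) - l * real (card J)\<bar> < u) \<and> (\<forall>j\<in>J. \<bar>real (card (G\<inverse> `` {j})) - l * real (card I)\<bar> < v)"

text \<open>Pigeonhole over the possible margins: a row sum takes at most \<open>card J + 1\<close>
  values and a column sum at most \<open>card I + 1\<close>.\<close>

lemma balanced_margin_class:
  fixes l u v :: real
  assumes fin: "finite I" "finite J" and ne: "{G. G \<subseteq> I \<times> J \<and> card G = M \<and> balanced I J l u v G} \<noteq> {}"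
  shows "\<exists>s t. (\<forall>i\<in>I. \<bar>real (s i) - l * real (card J)\<bar> < u) \<and> (\<forall>j\<in>J. \<bar>real (t j) - l * real (card I)\<bar> < v) \<and>
     (\<Sum>i\<in>I. s i) = M \<and> (\<Sum>j\<in>J. t j) = M \<and>
     card {G. G \<subseteq> I \<times> J \<and> card G = M \<and> balanced I J l u v G}
       \<le> (card J + 1) ^ card I * (card I + 1) ^ card J * card (margin_class I J s t)"
proof -
  let ?S = "{G. G \<subseteq> I \<times> J \<and> card G = M \<and> balanced I J l u v G}"
  let ?R = "(I \<rightarrow>\<^sub>E {..card J}) \<times> (J \<rightarrow>\<^sub>E {..card I})"
  \<comment> \<open>Restriction to \<open>I\<close> and \<open>J\<close> places the margins in a
    finite extensional function space.\<close>
  let ?k = "\<lambda>G. (\<lambda>i\<in>I. card (G `` {i}), \<lambda>j\<in>J. card (G\<inverse> `` {j}))"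
  have finS: "finite ?S" by (rule finite_subset[of _ "Pow (I \<times> J)"]) (auto simp: fin)
  have "\<exists>G\<in>?S. card ?S \<le> card ?R * card {H \<in> ?S. ?k H = ?k G}"
  proof (rule pigeonhole_fiber[OF finS ne])
    show "finite ?R" using fin by (auto intro!: finite_PiE)
    show "?k ` ?S \<subseteq> ?R"
    proof
      fix z assume "z \<in> ?k ` ?S"
      then obtain G where G: "G \<subseteq> I \<times> J" and z: "z = ?k G" by auto
      have "card (G `` {i}) \<le> card J" for i by (rule card_mono) (use G fin in auto)
      moreover have "card (G\<inverse> `` {j}) \<le> card I" for j by (rule card_mono) (use G fin in auto)
      ultimately show "z \<in> ?R" unfolding z by auto
    qed
  qed
  then obtain G where G: "G \<in> ?S" and le: "card ?S \<le> card ?R * card {H \<in> ?S. ?k H = ?k G}" by blast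
  define s where "s i = card (G `` {i})" for i
  define t where "t j = card (G\<inverse> `` {j})" for j
  have R: "card ?R = (card J + 1) ^ card I * (card I + 1) ^ card J"
    using fin by (simp add: card_cartesian_product card_PiE)
  have "{H \<in> ?S. ?k H = ?k G} \<subseteq> margin_class I J s t"
  proof
    fix H assume "H \<in> {H \<in> ?S. ?k H = ?k G}"
    then have H: "H \<subseteq> I \<times> J" "(\<lambda>i\<in>I. card (H `` {i})) = (\<lambda>i\<in>I. card (G `` {i}))"
      "(\<lambda>j\<in>J. card (H\<inverse> `` {j})) = (\<lambda>j\<in>J. card (G\<inverse> `` {j}))" by auto
    have "card (H `` {i}) = s i" if "i \<in> I" for i
      using that fun_cong[OF H(2), of i] by (simp add: s_def)
    moreover have "card (H\<inverse> `` {j}) = t j" if "j \<in> J" for j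
      using that fun_cong[OF H(3), of j] by (simp add: t_def)
    ultimately show "H \<in> margin_class I J s t" using H(1) by (simp add: margin_class_def)
  qed
  then have "card {H \<in> ?S. ?k H = ?k G} \<le> card (margin_class I J s t)"
    by (rule card_mono[OF finite_margin_class[OF fin]])
  then have "card ?S \<le> card ?R * card (margin_class I J s t)"
    using le by (meson le_trans mult_le_mono2)
  moreover have "(\<Sum>i\<in>I. s i) = M" "(\<Sum>j\<in>J. t j) = M"
    using G card_eq_sum_rows[OF fin, of G] card_eq_sum_cols[OF fin, of G] by (auto simp: s_def t_def)
  moreover have "\<forall>i\<in>I. \<bar>real (s i) - l * real (card J)\<bar> < u" "\<forall>j\<in>J. \<bar>real (t j) - l * real (card I)\<bar> < v"
    using G by (auto simp: balanced_def s_def t_def)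
  ultimately show ?thesis unfolding R by blast
qed

text \<open>Exactly \<open>M\<close> ones occur with probability at least
  \<open>1 / (card I * card J + 1)\<close> by \<open>binomial_mode\<close>, and \<open>small\<close>
  makes all row and column tails together cost at most half of this.\<close>

lemma balanced_weight:
  fixes l u v :: real
  assumes fin: "finite I" "finite J" "I \<noteq> {}" "J \<noteq> {}" and l: "0 \<le> l" "l < 1"
    and M: "real M = l * (card I * card J)"
    and u: "0 \<le> u" "u \<le> 2 * real (card J)" and v: "0 \<le> v" "v \<le> 2 * real (card I)"
    and small: "2 * real (card I) * exp (- (u\<^sup>2 / (4 * real (card J)))) + 2 * real (card J) * exp (- (v\<^sup>2 / (4 * real (card I))))
                  \<le> 1 / (2 * (real (card I) * real (card J) + 1))"
  shows "1 / (2 * (real (card I) * real (card J) + 1))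
           \<le> card {G. G \<subseteq> I \<times> J \<and> card G = M \<and> balanced I J l u v G} * (l ^ M * (1 - l) ^ (card I * card J - M))"
proof -
  let ?\<Omega> = "I \<times> J" and ?m = "card I" and ?n = "card J"
  let ?S = "{G. G \<subseteq> ?\<Omega> \<and> card G = M \<and> balanced I J l u v G}"
  let ?w = "binomial_weight l ?\<Omega>"
  let ?R = "\<lambda>i. {G \<in> Pow ?\<Omega>. u \<le> \<bar>card (G \<inter> {i} \<times> J) - l * card ({i} \<times> J)\<bar>}"
  let ?C = "\<lambda>j. {G \<in> Pow ?\<Omega>. v \<le> \<bar>card (G \<inter> I \<times> {j}) - l * card (I \<times> {j})\<bar>}"
  have fin\<Omega>: "finite ?\<Omega>" using fin by simp
  have w0: "0 \<le> ?w G" for G by (rule binomial_weight_nonneg) (use l in auto)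
  have n0: "0 < ?m" "0 < ?n" using fin by (auto simp: card_gt_0_iff)
  have R: "sum ?w (?R i) \<le> 2 * exp (- (u\<^sup>2 / (4 * real ?n)))" if "i \<in> I" for i
    by (rule chernoff) (use that fin l u n0 in \<open>auto simp: card_cartesian_product\<close>)
  have C: "sum ?w (?C j) \<le> 2 * exp (- (v\<^sup>2 / (4 * real ?m)))" if "j \<in> J" for j
    by (rule chernoff) (use that fin l v n0 in \<open>auto simp: card_cartesian_product\<close>)
  have fR: "finite (?R i)" "finite (?C j)" for i j using fin\<Omega> by auto
  have finS: "finite ?S" by (rule finite_subset[of _ "Pow ?\<Omega>"]) (auto simp: fin)
  have sub: "{G. G \<subseteq> ?\<Omega> \<and> card G = M} \<subseteq> ?S \<union> ((\<Union>i\<in>I. ?R i) \<union> (\<Union>j\<in>J. ?C j))"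
  proof (rule subsetI, rule ccontr)
    fix G assume "G \<in> {G. G \<subseteq> ?\<Omega> \<and> card G = M}" "G \<notin> ?S \<union> ((\<Union>i\<in>I. ?R i) \<union> (\<Union>j\<in>J. ?C j))"
    then have G: "G \<subseteq> ?\<Omega>" "card G = M" "G \<notin> (\<Union>j\<in>J. ?C j)" "G \<notin> (\<Union>i\<in>I. ?R i)" "G \<notin> ?S"
      by blast+
    have "card (G \<inter> {i} \<times> J) = card (G `` {i})" for i
    proof -
      have "G \<inter> {i} \<times> J = {i} \<times> G `` {i}" using G(1) by auto
      then show ?thesis by (simp add: card_cartesian_product)
    qed
    moreover have "card (G \<inter> I \<times> {j}) = card (G\<inverse> `` {j})" for j
    proof -
      have "G \<inter> I \<times> {j} = G\<inverse> `` {j} \<times> {j}" using G(1) by auto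
      then show ?thesis by (simp add: card_cartesian_product)
    qed
    ultimately have "balanced I J l u v G"
      using G(1,3,4) by (auto simp: balanced_def card_cartesian_product not_le)
    then show False using G by blast
  qed
  have "1 / (real ?m * real ?n + 1) \<le> (?m * ?n choose M) * l ^ M * (1 - l) ^ (?m * ?n - M)"
    using binomial_mode[OF l, of M "?m * ?n"] M by simp
  also have "\<dots> = sum ?w {G. G \<subseteq> ?\<Omega> \<and> card G = M}"
    using fin\<Omega> by (simp add: binomial_weight_def n_subsets card_cartesian_product)
  also have "\<dots> \<le> sum ?w (?S \<union> ((\<Union>i\<in>I. ?R i) \<union> (\<Union>j\<in>J. ?C j)))"
    by (rule sum_mono2[OF _ sub]) (rule finite_UnI finite_UN_I fin fR w0 finS)+
  also have "\<dots> \<le> sum ?w ?S + (sum ?w (\<Union>i\<in>I. ?R i) + sum ?w (\<Union>j\<in>J. ?C j))"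
    by (rule order_trans[OF sum_Un_le] add_left_mono sum_Un_le finite_UnI finite_UN_I fin fR w0 finS)+
  also have "sum ?w ?S = card ?S * (l ^ M * (1 - l) ^ (?m * ?n - M))"
    by (simp add: binomial_weight_def card_cartesian_product)
  also have "sum ?w (\<Union>i\<in>I. ?R i) \<le> (\<Sum>i\<in>I. sum ?w (?R i))"
    by (rule sum_UN_le[OF fin(1) fR(1) w0])
  also have "\<dots> \<le> 2 * real ?m * exp (- (u\<^sup>2 / (4 * real ?n)))"
    using sum_bounded_above[OF R, of I] by (simp add: mult_ac)
  also have "sum ?w (\<Union>j\<in>J. ?C j) \<le> (\<Sum>j\<in>J. sum ?w (?C j))"
    by (rule sum_UN_le[OF fin(2) fR(2) w0])
  also have "\<dots> \<le> 2 * real ?n * exp (- (v\<^sup>2 / (4 * real ?m)))"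
    using sum_bounded_above[OF C, of J] by (simp add: mult_ac)
  finally have "1 / (real ?m * real ?n + 1) \<le> card ?S * (l ^ M * (1 - l) ^ (?m * ?n - M))
      + (2 * real ?m * exp (- (u\<^sup>2 / (4 * real ?n))) + 2 * real ?n * exp (- (v\<^sup>2 / (4 * real ?m))))"
    by simp
  moreover have double: "2 * (1 / (2 * z)) = 1 / z" for z :: real by simp
  moreover have arith: "a \<le> d" if "2 * a \<le> d + c" "c \<le> a" for a c d :: real using that by linarith
  ultimately show ?thesis by (intro arith[OF _ small]) (simp only: double)
qed

text \<open>Some margins \<open>s'\<close>, \<open>t'\<close> near the mean are popular. Transfers
  turn first \<open>s'\<close> into \<open>s\<close> with column sums \<open>t'\<close>, then
  \<open>t'\<close> into \<open>t\<close> with row sums \<open>s\<close>; the polynomial and power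
  factors on the right are the price of \<open>balanced_weight\<close> and of the
  pigeonhole.\<close>

lemma margin_class_lower_bound:
  fixes \<alpha> l u v :: real
  assumes fin: "finite I" "finite J" "I \<noteq> {}" "J \<noteq> {}"
    and \<alpha>: "0 < \<alpha>" "2 * \<alpha> \<le> l" "l \<le> 1/2" "2 \<le> \<alpha> * card I" "2 \<le> \<alpha> * card J"
    and u: "0 \<le> u" "256 * u \<le> \<alpha> * card J" and v: "0 \<le> v" "256 * v \<le> \<alpha> * card I"
    and s: "\<And>i. i \<in> I \<Longrightarrow> \<bar>real (s i) - l * real (card J)\<bar> \<le> u"
    and t: "\<And>j. j \<in> J \<Longrightarrow> \<bar>real (t j) - l * real (card I)\<bar> \<le> v"
    and sum: "(\<Sum>i\<in>I. s i) = M" "(\<Sum>j\<in>J. t j) = M" and M: "real M = l * (card I * card J)"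
    and small: "2 * real (card I) * exp (- (u\<^sup>2 / (4 * real (card J))))
                  + 2 * real (card J) * exp (- (v\<^sup>2 / (4 * real (card I))))
                  \<le> 1 / (2 * (real (card I) * real (card J) + 1))"
  shows "move_cost \<alpha> u (card J) ^ card I * move_cost \<alpha> v (card I) ^ card J
    \<le> 2 * (real (card I) * real (card J) + 1) * (real (card J) + 1) ^ card I * (real (card I) + 1) ^ card J
         * (card (margin_class I J s t) * (l ^ M * (1 - l) ^ (card I * card J - M)))"
proof -
  let ?m = "card I" and ?n = "card J" and ?\<kappa> = "move_cost \<alpha> u (card J)" and ?\<mu> = "move_cost \<alpha> v (card I)"
  define \<omega> where "\<omega> = l ^ M * (1 - l) ^ (?m * ?n - M)"
  let ?S = "{G. G \<subseteq> I \<times> J \<and> card G = M \<and> balanced I J l u v G}"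
  have \<omega>: "0 \<le> \<omega>" using \<alpha> by (simp add: \<omega>_def)
  have \<kappa>: "0 \<le> ?\<kappa>" "0 \<le> ?\<mu>" using \<alpha> by (auto simp: move_cost_def)
  have lm: "2 * \<alpha> * real k \<le> l * real k" "l * real k \<le> 1/2 * real k" for k
    by (rule mult_right_mono; use \<alpha> in simp)+
  have low: "1 / (2 * (real ?m * real ?n + 1)) \<le> card ?S * \<omega>"
    unfolding \<omega>_def
  proof (rule balanced_weight[OF fin _ _ M u(1) _ v(1) _ small])
    show "u \<le> 2 * real ?n" "v \<le> 2 * real ?m" using u v lm[of ?n] lm[of ?m] by linarith+
  qed (use \<alpha> in linarith)+
  have "0 < 1 / (2 * (real ?m * real ?n + 1))" by (simp add: add_nonneg_pos)
  then have "card ?S \<noteq> 0" using low by (intro notI) simp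
  then have "?S \<noteq> {}" by (metis card.empty)
  then obtain s' t' where s': "\<And>i. i \<in> I \<Longrightarrow> \<bar>real (s' i) - l * real ?n\<bar> < u"
    and t': "\<And>j. j \<in> J \<Longrightarrow> \<bar>real (t' j) - l * real ?m\<bar> < v"
    and sum': "(\<Sum>i\<in>I. s' i) = M" "(\<Sum>j\<in>J. t' j) = M"
    and le: "card ?S \<le> (?n + 1) ^ ?m * (?m + 1) ^ ?n * card (margin_class I J s' t')"
    using balanced_margin_class[OF fin(1,2) \<open>?S \<noteq> {}\<close>] by (elim exE conjE) (rule that; blast)
  have a: "\<alpha> \<le> 1/4" using \<alpha> by linarith
  \<comment> \<open>Since \<open>\<alpha> \<le> 1/4\<close> and
    \<open>2 * \<alpha> \<le> l \<le> 1/2\<close>, margins within \<open>w\<close> of the mean keep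
    a distance \<open>\<alpha> * k\<close> from both 0 and \<open>k\<close>, as the transfers
    require of the margins that they do not change.\<close>
  have window: "\<alpha> * real k \<le> x \<and> x \<le> (1 - \<alpha>) * real k"
    if "\<bar>x - l * real k\<bar> \<le> w" "256 * w \<le> \<alpha> * real k" for x w :: real and k
  proof -
    have "\<alpha> * real k \<le> 1/4 * real k" by (rule mult_right_mono[OF a]) simp
    then have "l * real k + w \<le> (1 - \<alpha>) * real k" "\<alpha> * real k \<le> l * real k - w"
      using lm[of k] that by (simp_all add: left_diff_distrib)
    then show ?thesis using that by linarith
  qed
  have row_moves: "?\<kappa> ^ ?m * card (margin_class I J s' t') \<le> card (margin_class I J s t')"
  proof (rule rows_move[OF fin(1,2) \<alpha>(1) _ \<alpha>(4) fin(4) _ u(2) s])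
    show "\<alpha> * ?m \<le> t' j \<and> t' j \<le> (1 - \<alpha>) * ?m" if "j \<in> J" for j
      using window[OF less_imp_le[OF t'[OF that]] v(2)] .
    show "\<bar>real (s' i) - l * real ?n\<bar> \<le> u" if "i \<in> I" for i using s'[OF that] by simp
  qed (use a sum sum' in auto)
  \<comment> \<open>The same transfers, applied to the transposed matrices.\<close>
  have col_moves: "?\<mu> ^ ?n * card (margin_class J I t' s) \<le> card (margin_class J I t s)"
  proof (rule rows_move[OF fin(2,1) \<alpha>(1) _ \<alpha>(5) fin(3) _ v(2) t])
    show "\<alpha> * ?n \<le> s i \<and> s i \<le> (1 - \<alpha>) * ?n" if "i \<in> I" for i
      using window[OF s[OF that] u(2)] .
    show "\<bar>real (t' j) - l * real ?m\<bar> \<le> v" if "j \<in> J" for j using t'[OF that] by simp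
  qed (use a sum sum' in auto)
  have moves: "?\<mu> ^ ?n * (?\<kappa> ^ ?m * card (margin_class I J s' t')) \<le> card (margin_class I J s t)"
  proof -
    have "?\<mu> ^ ?n * (?\<kappa> ^ ?m * card (margin_class I J s' t')) \<le> ?\<mu> ^ ?n * card (margin_class I J s t')"
      by (rule mult_left_mono[OF row_moves]) (simp add: \<kappa>)
    also have "\<dots> \<le> card (margin_class I J s t)"
      using col_moves by (simp only: card_margin_class_transpose[of J I])
    finally show ?thesis .
  qed
  let ?P = "(real ?n + 1) ^ ?m * (real ?m + 1) ^ ?n"
  have "real (card ?S) \<le> real ((?n + 1) ^ ?m * (?m + 1) ^ ?n * card (margin_class I J s' t'))"
    using le by (simp only: of_nat_le_iff)
  also have "\<dots> = ?P * card (margin_class I J s' t')"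
    by (simp add: add.commute)
  finally have S: "real (card ?S) \<le> ?P * card (margin_class I J s' t')" .
  have "?\<kappa> ^ ?m * ?\<mu> ^ ?n * 1 \<le> ?\<kappa> ^ ?m * ?\<mu> ^ ?n * (2 * (real ?m * real ?n + 1) * (card ?S * \<omega>))"
  proof (rule mult_left_mono)
    have z: "0 < 2 * (real ?m * real ?n + 1)" by (simp add: add_nonneg_pos)
    show "1 \<le> 2 * (real ?m * real ?n + 1) * (card ?S * \<omega>)"
      using low unfolding pos_divide_le_eq[OF z] by (simp only: mult.commute)
  qed (use \<kappa> in auto)
  also have "\<dots> \<le> ?\<kappa> ^ ?m * ?\<mu> ^ ?n * (2 * (real ?m * real ?n + 1) * (?P * card (margin_class I J s' t') * \<omega>))"
    by (intro mult_left_mono mult_right_mono S \<omega>) (use \<kappa> in auto)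
  also have "\<dots> = 2 * (real ?m * real ?n + 1) * ?P * \<omega> * (?\<mu> ^ ?n * (?\<kappa> ^ ?m * card (margin_class I J s' t')))"
    by simp
  also have "\<dots> \<le> 2 * (real ?m * real ?n + 1) * ?P * \<omega> * card (margin_class I J s t)"
    by (intro mult_left_mono moves) (use \<omega> in auto)
  finally show ?thesis by (simp add: \<omega>_def mult_ac)
qed

section \<open>Discrepancy of matrices with given margins\<close>

definition deviating :: "'a set \<Rightarrow> 'b set \<Rightarrow> real \<Rightarrow> real \<Rightarrow> ('a \<times> 'b) set \<Rightarrow> bool" where
  "deviating I J l x G \<longleftrightarrow>
     (\<exists>A B. A \<subseteq> I \<and> B \<subseteq> J \<and> x \<le> \<bar>real (card (G \<inter> A \<times> B)) - l * real (card A) * real (card B)\<bar>)"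

text \<open>Dropping the margin condition only adds nonnegative weight; a union bound over the
  \<open>2 ^ (card I + card J)\<close> pairs then uses \<open>chernoff\<close> with the common size
  bound \<open>card I * card J\<close>.\<close>

lemma deviating_weight:
  fixes l x :: real
  assumes fin: "finite I" "finite J" "I \<noteq> {}" "J \<noteq> {}" and l: "0 \<le> l" "l \<le> 1"
    and x: "0 \<le> x" "x \<le> 2 * (real (card I) * real (card J))" and sum: "(\<Sum>i\<in>I. s i) = M"
  shows "card {G \<in> margin_class I J s t. deviating I J l x G} * (l ^ M * (1 - l) ^ (card I * card J - M))
           \<le> 2 ^ (card I + card J) * (2 * exp (- (x\<^sup>2 / (4 * (real (card I) * real (card J))))))"
proof -
  let ?\<Omega> = "I \<times> J" and ?m = "card I" and ?n = "card J"
  let ?w = "binomial_weight l ?\<Omega>" and ?D = "{G \<in> margin_class I J s t. deviating I J l x G}"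
  let ?E = "\<lambda>(A, B). {G \<in> Pow ?\<Omega>. x \<le> \<bar>card (G \<inter> A \<times> B) - l * card (A \<times> B)\<bar>}"
  have w0: "0 \<le> ?w G" for G by (rule binomial_weight_nonneg) (use l in auto)
  have fE: "finite (?E p)" for p using fin by (auto split: prod.split)
  have mn: "0 < ?m * ?n" using fin by (auto simp: card_gt_0_iff)
  have "card ?D * (l ^ M * (1 - l) ^ (?m * ?n - M)) = (\<Sum>G\<in>?D. l ^ M * (1 - l) ^ (?m * ?n - M))"
    by simp
  also have "\<dots> = sum ?w ?D"
    by (rule sum.cong[OF refl]) (use binomial_weight_margin_class[OF fin(1,2) sum] in auto)
  also have "\<dots> \<le> sum ?w (\<Union>p\<in>Pow I \<times> Pow J. ?E p)"
  proof (rule sum_mono2)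
    show "?D \<subseteq> (\<Union>p\<in>Pow I \<times> Pow J. ?E p)"
    proof
      fix G assume "G \<in> ?D"
      then obtain A B where "A \<subseteq> I" "B \<subseteq> J" "G \<subseteq> ?\<Omega>"
        and "x \<le> \<bar>real (card (G \<inter> A \<times> B)) - l * real (card A) * real (card B)\<bar>"
        by (auto simp: deviating_def margin_class_def)
      then have "G \<in> ?E (A, B)" "(A, B) \<in> Pow I \<times> Pow J" by (auto simp: card_cartesian_product mult_ac)
      then show "G \<in> (\<Union>p\<in>Pow I \<times> Pow J. ?E p)" by blast
    qed
    show "finite (\<Union>p\<in>Pow I \<times> Pow J. ?E p)" by (intro finite_UN_I finite_cartesian_product fE) (auto simp: fin)
  qed (rule w0)
  also have "\<dots> \<le> (\<Sum>p\<in>Pow I \<times> Pow J. sum ?w (?E p))"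
    by (rule sum_UN_le[OF _ fE w0]) (use fin in auto)
  also have "\<dots> \<le> (\<Sum>p\<in>Pow I \<times> Pow J. 2 * exp (- (x\<^sup>2 / (4 * real (?m * ?n)))))"
  proof (rule sum_mono)
    fix p assume "p \<in> Pow I \<times> Pow J"
    then obtain A B where p: "p = (A, B)" "A \<subseteq> I" "B \<subseteq> J" by auto
    have "sum ?w {G \<in> Pow ?\<Omega>. x \<le> \<bar>card (G \<inter> A \<times> B) - l * card (A \<times> B)\<bar>}
        \<le> 2 * exp (- (x\<^sup>2 / (4 * real (?m * ?n))))"
    proof (rule chernoff)
      show "card (A \<times> B) \<le> ?m * ?n"
        using p fin by (simp add: card_cartesian_product mult_le_mono card_mono)
    qed (use p fin l x mn in auto)
    then show "sum ?w (?E p) \<le> 2 * exp (- (x\<^sup>2 / (4 * real (?m * ?n))))" by (simp add: p)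
  qed
  also have "\<dots> = 2 ^ (?m + ?n) * (2 * exp (- (x\<^sup>2 / (4 * (real ?m * real ?n)))))"
    using fin by (simp add: card_cartesian_product card_Pow power_add)
  finally show ?thesis .
qed

text \<open>All matrices of the class have the same weight, which cancels when the bound for
  deviating matrices is divided by the lower bound for the class. Positivity of the latter also
  shows that matrices with these margins exist.\<close>

lemma deviating_fraction:
  fixes \<alpha> l u v x :: real
  assumes fin: "finite I" "finite J" "I \<noteq> {}" "J \<noteq> {}"
    and \<alpha>: "0 < \<alpha>" "2 * \<alpha> \<le> l" "l \<le> 1/2" "2 \<le> \<alpha> * card I" "2 \<le> \<alpha> * card J"
    and u: "0 \<le> u" "256 * u \<le> \<alpha> * card J" and v: "0 \<le> v" "256 * v \<le> \<alpha> * card I"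
    and s: "\<And>i. i \<in> I \<Longrightarrow> \<bar>real (s i) - l * real (card J)\<bar> \<le> u"
    and t: "\<And>j. j \<in> J \<Longrightarrow> \<bar>real (t j) - l * real (card I)\<bar> \<le> v"
    and sum: "(\<Sum>i\<in>I. s i) = M" "(\<Sum>j\<in>J. t j) = M" and M: "real M = l * (card I * card J)"
    and small: "2 * real (card I) * exp (- (u\<^sup>2 / (4 * real (card J))))
                  + 2 * real (card J) * exp (- (v\<^sup>2 / (4 * real (card I))))
                  \<le> 1 / (2 * (real (card I) * real (card J) + 1))"
    and x: "0 \<le> x" "x \<le> 2 * (real (card I) * real (card J))"
  shows "margin_class I J s t \<noteq> {}"
    and "card {G \<in> margin_class I J s t. deviating I J l x G} / card (margin_class I J s t)
      \<le> 2 ^ (card I + card J) * (2 * exp (- (x\<^sup>2 / (4 * (real (card I) * real (card J))))))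
         * (2 * (real (card I) * real (card J) + 1) * (real (card J) + 1) ^ card I * (real (card I) + 1) ^ card J)
         / (move_cost \<alpha> u (card J) ^ card I * move_cost \<alpha> v (card I) ^ card J)"
proof -
  let ?m = "card I" and ?n = "card J"
  define \<omega> where "\<omega> = l ^ M * (1 - l) ^ (?m * ?n - M)"
  define Q where "Q = 2 * (real ?m * real ?n + 1) * (real ?n + 1) ^ ?m * (real ?m + 1) ^ ?n"
  define k where "k = move_cost \<alpha> u ?n ^ ?m * move_cost \<alpha> v ?m ^ ?n"
  define N where "N = real (card (margin_class I J s t))"
  define D where "D = real (card {G \<in> margin_class I J s t. deviating I J l x G})"
  define e where "e = 2 ^ (?m + ?n) * (2 * exp (- (x\<^sup>2 / (4 * (real ?m * real ?n)))))"
  have low: "k \<le> Q * (N * \<omega>)"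
    unfolding k_def Q_def N_def \<omega>_def by (rule margin_class_lower_bound[OF fin \<alpha> u v s t sum M small])
  have k: "0 < k" using \<alpha> by (simp add: k_def move_cost_def)
  have Q: "0 < Q" unfolding Q_def by (intro mult_pos_pos zero_less_power add_nonneg_pos) auto
  have "0 < Q * (N * \<omega>)" using low k by linarith
  then have pos: "0 < N * \<omega>" by (rule zero_less_mult_pos) (rule Q)
  have N: "0 < N" using pos by (cases "N = 0") (auto simp: N_def)
  then show "margin_class I J s t \<noteq> {}" by (auto simp: N_def)
  have D: "D * \<omega> \<le> e"
    unfolding D_def \<omega>_def e_def
    by (rule deviating_weight[OF fin _ _ x sum(1)]) (use \<alpha> in auto)
  have \<omega>: "0 < \<omega>" using pos N by (simp add: zero_less_mult_iff)
  have "D / N = D * \<omega> / (N * \<omega>)" using \<omega> by simp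
  also have "\<dots> \<le> e / (N * \<omega>)" by (rule divide_right_mono[OF D]) (use pos in simp)
  also have "\<dots> \<le> e / (k / Q)"
  proof (rule divide_left_mono)
    show "k / Q \<le> N * \<omega>" using low Q by (simp add: pos_divide_le_eq mult.commute)
    show "0 < N * \<omega> * (k / Q)" by (rule mult_pos_pos[OF pos divide_pos_pos[OF k Q]])
  qed (simp add: e_def)
  also have "\<dots> = e * Q / k" by simp
  finally show "D / N \<le> e * Q / k" .
qed

section \<open>Bipartite graphs and the asymptotic regime\<close>

definition pair_edge :: "nat \<times> nat \<Rightarrow> vertex set" where
  "pair_edge = (\<lambda>(i, j). {Inl i, Inr j})"

lemma inj_pair_edge: "inj pair_edge"
  by (auto simp: inj_def pair_edge_def doubleton_eq_iff)

lemma inj_image_pair_edge: "inj_on ((`) pair_edge) X"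
  by (auto simp: inj_on_def inj_image_eq_iff[OF inj_pair_edge])

lemma bipartite_graphs_eq: "bipartite_graphs m n = (`) pair_edge ` Pow ({1..m} \<times> {1..n})"
proof -
  have "{{u, w} |u w. u \<in> part_U m \<and> w \<in> part_W n} = pair_edge ` ({1..m} \<times> {1..n})"
    by (auto simp: part_U_def part_W_def pair_edge_def image_iff)
  then show ?thesis by (simp add: bipartite_graphs_def image_Pow_surj)
qed

lemma vertex_degree_pair_edge:
  "vertex_degree (pair_edge ` G) (Inl i) = card (G `` {i})"
  "vertex_degree (pair_edge ` G) (Inr j) = card (G\<inverse> `` {j})"
proof -
  have "{e \<in> pair_edge ` G. Inl i \<in> e} = (\<lambda>j. pair_edge (i, j)) ` (G `` {i})"
    by (auto simp: pair_edge_def)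
  then show "vertex_degree (pair_edge ` G) (Inl i) = card (G `` {i})"
    by (simp add: vertex_degree_def card_image inj_on_def pair_edge_def doubleton_eq_iff)
  have "{e \<in> pair_edge ` G. Inr j \<in> e} = (\<lambda>i. pair_edge (i, j)) ` (G\<inverse> `` {j})"
    by (auto simp: pair_edge_def)
  then show "vertex_degree (pair_edge ` G) (Inr j) = card (G\<inverse> `` {j})"
    by (simp add: vertex_degree_def card_image inj_on_def pair_edge_def doubleton_eq_iff)
qed

lemma edges_between_pair_edge:
  "edges_between (pair_edge ` G) (Inl ` A) (Inr ` B) = card (G \<inter> A \<times> B)"
proof -
  have "{e \<in> pair_edge ` G. \<exists>a\<in>Inl ` A. \<exists>b\<in>Inr ` B. e = {a, b}} = pair_edge ` (G \<inter> A \<times> B)"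
    by (auto simp: pair_edge_def doubleton_eq_iff)
  then show ?thesis
    by (simp add: edges_between_def card_image inj_on_subset[OF inj_pair_edge])
qed

lemma graphs_with_degrees_eq:
  "graphs_with_degrees m n s t = (`) pair_edge ` margin_class {1..m} {1..n} s t"
  by (auto simp: graphs_with_degrees_def bipartite_graphs_eq margin_class_def vertex_degree_pair_edge)

text \<open>Nonemptiness makes \<open>pmf_of_set\<close> the uniform distribution on the class. An
  inclusion of events suffices, as a matrix that is not \<open>deviating\<close> even satisfies the
  strict inequality.\<close>

lemma prob_random_graph_ge:
  fixes l x :: real
  assumes "margin_class {1..m} {1..n} s t \<noteq> {}"
  shows "1 - card {G \<in> margin_class {1..m} {1..n} s t. deviating {1..m} {1..n} l x G}
             / card (margin_class {1..m} {1..n} s t)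
    \<le> measure_pmf.prob (random_graph m n s t)
        {E. \<forall>A B. A \<subseteq> part_U m \<and> B \<subseteq> part_W n \<longrightarrow>
              \<bar>real (edges_between E A B) - l * real (card A) * real (card B)\<bar> \<le> x}"
    (is "1 - real (card ?D) / real (card ?\<G>) \<le> measure_pmf.prob _ ?X")
proof -
  have fin: "finite ?\<G>" by (simp add: finite_margin_class)
  have N: "0 < card ?\<G>" using assms fin by (simp add: card_gt_0_iff)
  have "(`) pair_edge ` (?\<G> - ?D) \<subseteq> graphs_with_degrees m n s t \<inter> ?X"
  proof
    fix E assume "E \<in> (`) pair_edge ` (?\<G> - ?D)"
    then obtain G where G: "G \<in> ?\<G>" "\<not> deviating {1..m} {1..n} l x G" and E: "E = pair_edge ` G" by auto
    have "\<bar>real (edges_between E A B) - l * real (card A) * real (card B)\<bar> \<le> x"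
      if AB: "A \<subseteq> part_U m" "B \<subseteq> part_W n" for A B
    proof -
      obtain A' where A': "A' \<subseteq> {1..m}" "A = Inl ` A'"
        using AB(1) unfolding part_U_def subset_image_iff by blast
      obtain B' where B': "B' \<subseteq> {1..n}" "B = Inr ` B'"
        using AB(2) unfolding part_W_def subset_image_iff by blast
      have "\<bar>real (card (G \<inter> A' \<times> B')) - l * real (card A') * real (card B')\<bar> < x"
        using G(2) A'(1) B'(1) unfolding deviating_def by (meson not_le)
      then show ?thesis
        by (simp add: E A'(2) B'(2) edges_between_pair_edge card_image)
    qed
    then show "E \<in> graphs_with_degrees m n s t \<inter> ?X"
      using G(1) by (auto simp: E graphs_with_degrees_eq)
  qed
  then have "card ((`) pair_edge ` (?\<G> - ?D)) \<le> card (graphs_with_degrees m n s t \<inter> ?X)"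
    by (rule card_mono[rotated]) (intro finite_Int disjI1, simp add: graphs_with_degrees_eq finite_margin_class)
  moreover have "card ((`) pair_edge ` (?\<G> - ?D)) = card ?\<G> - card ?D"
    by (subst card_image[OF inj_image_pair_edge], rule card_Diff_subset) (use fin in auto)
  moreover have "card ?D \<le> card ?\<G>" by (rule card_mono[OF fin]) auto
  ultimately have "real (card ?\<G>) - real (card ?D) \<le> card (graphs_with_degrees m n s t \<inter> ?X)"
    by linarith
  then have "(real (card ?\<G>) - real (card ?D)) / card ?\<G> \<le> card (graphs_with_degrees m n s t \<inter> ?X) / card ?\<G>"
    by (rule divide_right_mono) simp
  also have "\<dots> = measure_pmf.prob (random_graph m n s t) ?X"
    using assms fin unfolding random_graph_def
    by (subst measure_pmf_of_set) (auto simp: graphs_with_degrees_eq card_image[OF inj_image_pair_edge])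
  finally show ?thesis using N by (simp add: diff_divide_distrib)
qed

section \<open>Numerical estimates for large sizes\<close>

text \<open>Meant for \<open>y = n\<close> and \<open>y = m\<close>. The comparisons with linear
  terms make the windows narrow and the deviation at most \<open>2 * m * n\<close>; the logarithmic
  line absorbs the counting factors. The last line serves at \<open>y = n\<close>, where
  \<open>m \<le> n\<^sup>2\<close> lets \<open>y\<^sup>2\<close> bound the number of rows and
  \<open>y ^ 3\<close> bound \<open>m * n\<close>.\<close>

definition large_size :: "real \<Rightarrow> real \<Rightarrow> real \<Rightarrow> real \<Rightarrow> real \<Rightarrow> bool" where
  "large_size \<epsilon> \<alpha> b c y \<longleftrightarrow>
     1 \<le> y \<and> 2 \<le> \<alpha> * y \<and> 256 * (b * y powr (1/2 + \<epsilon>)) \<le> \<alpha> * y \<and> c * y powr (1/2 + \<epsilon>) \<le> y \<and>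
     2 * ln 2 + 2 * ln (y + 1) + ln (32 / \<alpha>) \<le> y powr (2 * \<epsilon>) \<and>
     2 * y\<^sup>2 * exp (- (y powr (2 * \<epsilon>) / 4)) \<le> 1 / (4 * (y ^ 3 + 1))"

lemma eventually_large_size:
  assumes "0 < \<epsilon>" "\<epsilon> < 1/4" "0 < \<alpha>" "0 < b" "0 < c"
  shows "eventually (large_size \<epsilon> \<alpha> b c) at_top"
proof -
  have "eventually (\<lambda>y::real. 1 \<le> y) at_top" by real_asymp
  moreover have "eventually (\<lambda>y::real. 2 \<le> \<alpha> * y) at_top" using assms by real_asymp
  moreover have "eventually (\<lambda>y::real. 256 * (b * y powr (1/2 + \<epsilon>)) \<le> \<alpha> * y) at_top"
    using assms by real_asymp
  moreover have "eventually (\<lambda>y::real. c * y powr (1/2 + \<epsilon>) \<le> y) at_top"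
    using assms by real_asymp
  moreover have "eventually (\<lambda>y::real. 2 * ln 2 + 2 * ln (y + 1) + ln (32 / \<alpha>) \<le> y powr (2 * \<epsilon>)) at_top"
    using assms by real_asymp
  moreover have "eventually (\<lambda>y::real. 2 * y\<^sup>2 * exp (- (y powr (2 * \<epsilon>) / 4)) \<le> 1 / (4 * (y ^ 3 + 1))) at_top"
    using assms by real_asymp
  ultimately show ?thesis
    unfolding large_size_def by eventually_elim auto
qed

lemma move_cost_eq_exp:
  assumes "0 < \<alpha>"
  shows "move_cost \<alpha> w k ^ j = exp (- (real j * (ln (32 / \<alpha>) + 512 * w\<^sup>2 / (\<alpha> * k))))"
proof -
  have "\<alpha> / 32 = exp (- ln (32 / \<alpha>))" using assms by (simp add: exp_minus)
  then have "move_cost \<alpha> w k = exp (- ln (32 / \<alpha>)) * exp (- (512 * w\<^sup>2 / (\<alpha> * k)))"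
    unfolding move_cost_def by simp
  also have "\<dots> = exp (- (ln (32 / \<alpha>) + 512 * w\<^sup>2 / (\<alpha> * k)))"
    by (simp only: minus_add_distrib exp_add)
  finally have "move_cost \<alpha> w k = exp (- (ln (32 / \<alpha>) + 512 * w\<^sup>2 / (\<alpha> * k)))" .
  then show ?thesis by (simp only: exp_of_nat_mult[symmetric] mult_minus_right)
qed

lemma powr_half_plus_squared:
  fixes y \<epsilon> :: real
  assumes "0 < y"
  shows "(y powr (1/2 + \<epsilon>))\<^sup>2 = y * y powr (2 * \<epsilon>)"
proof -
  have "(y powr (1/2 + \<epsilon>))\<^sup>2 = y powr (1/2 + \<epsilon> + (1/2 + \<epsilon>))"
    unfolding power2_eq_square by (rule powr_add[symmetric])
  also have "1/2 + \<epsilon> + (1/2 + \<epsilon>) = 1 + 2 * \<epsilon>" by simp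
  finally show ?thesis using assms by (simp add: powr_add)
qed

text \<open>The choice of \<open>c\<close> makes the Chernoff exponent at least
  \<open>(C + 2) * (m * a + n * d)\<close> for \<open>a = n powr (2 * \<epsilon>)\<close> and
  \<open>d = m powr (2 * \<epsilon>)\<close>. The part with \<open>C\<close> pays for the quadratic
  cost of the transfers, one further copy of \<open>m * a + n * d\<close> for all logarithmic terms,
  and the last copy leaves \<open>exp (- m)\<close>.\<close>

lemma fraction_bound_le_exp:
  fixes \<epsilon> \<alpha> b c C x :: real and m n :: nat
  assumes \<epsilon>: "0 < \<epsilon>" and \<alpha>: "0 < \<alpha>" and C: "C = 512 * b\<^sup>2 / \<alpha>" and c: "0 \<le> c" "c\<^sup>2 = 4 * (C + 2)"
    and large: "large_size \<epsilon> \<alpha> b c n" "large_size \<epsilon> \<alpha> b c m"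
    and x: "x = c * (real m * real n powr (1/2 + \<epsilon>) + real n * real m powr (1/2 + \<epsilon>))"
  shows "2 ^ (m + n) * (2 * exp (- (x\<^sup>2 / (4 * (real m * real n)))))
         * (2 * (real m * real n + 1) * (real n + 1) ^ m * (real m + 1) ^ n)
         / (move_cost \<alpha> (b * real n powr (1/2 + \<epsilon>)) n ^ m * move_cost \<alpha> (b * real m powr (1/2 + \<epsilon>)) m ^ n)
         \<le> exp (- real m)" (is "?e1 * (2 * ?e2) * (2 * ?q * ?p1 * ?p2) / (?k1 * ?k2) \<le> _")
proof -
  define a where "a = real n powr (2 * \<epsilon>)"
  define d where "d = real m powr (2 * \<epsilon>)"
  define A where "A = ln (32 / \<alpha>)"
  have mn: "1 \<le> real m" "1 \<le> real n" using large by (auto simp: large_size_def)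
  then have pos: "0 < real m" "0 < real n" by auto
  have a1: "1 \<le> a" "1 \<le> d" using mn \<epsilon> by (auto simp: a_def d_def intro!: ge_one_powr_ge_zero)
  have k1: "?k1 = exp (- (real m * (A + C * a)))"
  proof -
    have "512 * (b * real n powr (1/2 + \<epsilon>))\<^sup>2 / (\<alpha> * n) = C * a"
      using pos \<alpha> unfolding power_mult_distrib powr_half_plus_squared[OF pos(2)] by (simp add: C a_def)
    then show ?thesis unfolding move_cost_eq_exp[OF \<alpha>] A_def by simp
  qed
  have k2: "?k2 = exp (- (real n * (A + C * d)))"
  proof -
    have "512 * (b * real m powr (1/2 + \<epsilon>))\<^sup>2 / (\<alpha> * m) = C * d"
      using pos \<alpha> unfolding power_mult_distrib powr_half_plus_squared[OF pos(1)] by (simp add: C d_def)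
    then show ?thesis unfolding move_cost_eq_exp[OF \<alpha>] A_def by simp
  qed
  have e2: "?e2 \<le> exp (- ((C + 2) * (m * a + n * d)))"
  proof -
    \<comment> \<open>The nonnegative cross term of the square is dropped.\<close>
    have "(real m * real n powr (1/2 + \<epsilon>))\<^sup>2 + (real n * real m powr (1/2 + \<epsilon>))\<^sup>2
        \<le> (real m * real n powr (1/2 + \<epsilon>) + real n * real m powr (1/2 + \<epsilon>))\<^sup>2"
      by (simp add: power2_sum)
    then have "c\<^sup>2 * ((real m * real n powr (1/2 + \<epsilon>))\<^sup>2 + (real n * real m powr (1/2 + \<epsilon>))\<^sup>2) \<le> x\<^sup>2"
      unfolding x power_mult_distrib by (rule mult_left_mono) simp
    also have "c\<^sup>2 * ((real m * real n powr (1/2 + \<epsilon>))\<^sup>2 + (real n * real m powr (1/2 + \<epsilon>))\<^sup>2)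
        = (C + 2) * (m * a + n * d) * (4 * (real m * real n))"
      unfolding power_mult_distrib c(2) powr_half_plus_squared[OF pos(1)] powr_half_plus_squared[OF pos(2)]
      by (simp add: a_def d_def power2_eq_square algebra_simps)
    finally have "(C + 2) * (m * a + n * d) \<le> x\<^sup>2 / (4 * (real m * real n))"
      using mn by (subst pos_le_divide_eq) auto
    then show ?thesis by simp
  qed
  \<comment> \<open>\<open>m * n + 1\<close> is at most \<open>(n + 1) * (m + 1)\<close>, hence at
    most \<open>?p1 * ?p2\<close>; absorbing it so doubles the logarithms.\<close>
  have q: "?q \<le> exp (m * ln (real n + 1) + n * ln (real m + 1))"
  proof -
    have "ln (real n + 1) \<le> m * ln (real n + 1)" "ln (real m + 1) \<le> n * ln (real m + 1)"
      using mn mult_right_mono[of 1 "real m" "ln (real n + 1)"] mult_right_mono[of 1 "real n" "ln (real m + 1)"] by auto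
    then have "exp (ln (real n + 1) + ln (real m + 1)) \<le> exp (m * ln (real n + 1) + n * ln (real m + 1))" by simp
    moreover have "?q \<le> (real n + 1) * (real m + 1)" using mn by (simp add: algebra_simps)
    ultimately show ?thesis using mn by (simp add: exp_add)
  qed
  have two: "(2::real) = exp (ln 2)" by simp
  have e1: "?e1 = exp (real (m + n) * ln 2)" by (simp only: exp_of_nat_mult) simp
  have p: "?p1 = exp (m * ln (real n + 1))" "?p2 = exp (n * ln (real m + 1))"
    using mn by (simp_all add: exp_of_nat_mult)
  have "?e1 * (2 * ?e2) * (2 * ?q * ?p1 * ?p2) / (?k1 * ?k2)
      \<le> ?e1 * (2 * exp (- ((C + 2) * (m * a + n * d))))
         * (2 * exp (m * ln (real n + 1) + n * ln (real m + 1)) * ?p1 * ?p2) / (?k1 * ?k2)"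
    unfolding k1 k2 by (intro divide_right_mono mult_mono e2 q order_refl) auto
  also have "\<dots> = exp (real (m + n) * ln 2) * (exp (ln 2) * exp (- ((C + 2) * (m * a + n * d))))
         * (exp (ln 2) * exp (m * ln (real n + 1) + n * ln (real m + 1)) * exp (m * ln (real n + 1)) * exp (n * ln (real m + 1)))
         / (exp (- (real m * (A + C * a))) * exp (- (real n * (A + C * d))))"
    unfolding e1 p k1 k2 by simp
  also have "\<dots> = exp (real (m + n) * ln 2 + (ln 2 + - ((C + 2) * (m * a + n * d)))
         + (ln 2 + (m * ln (real n + 1) + n * ln (real m + 1)) + m * ln (real n + 1) + n * ln (real m + 1))
         - (- (real m * (A + C * a)) + - (real n * (A + C * d))))"
    by (simp only: exp_add exp_diff)
  also have "\<dots> \<le> exp (- real m)"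
  proof -
    have "2 * ln 2 \<le> real (m + n) * ln 2" using mn by (intro mult_right_mono) auto
    moreover have "m * (2 * ln 2 + 2 * ln (real n + 1) + A) \<le> m * a"
      using large by (intro mult_left_mono) (auto simp: large_size_def a_def A_def)
    moreover have "n * (2 * ln 2 + 2 * ln (real m + 1) + A) \<le> n * d"
      using large by (intro mult_left_mono) (auto simp: large_size_def d_def A_def)
    moreover have "real m * 1 \<le> real m * a" by (rule mult_left_mono) (use a1 in auto)
    moreover have "0 \<le> n * d" using a1 by simp
    ultimately show ?thesis by (simp add: algebra_simps)
  qed
  finally show ?thesis .
qed

text \<open>The main point left is smallness of the row and column tails: \<open>b \<ge> 1\<close>
  gives them exponents of at least \<open>n powr (2 * \<epsilon>) / 4\<close>, which outweighs the
  polynomial factors once \<open>m \<le> n\<^sup>2\<close> bounds these by powers of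
  \<open>n\<close>.\<close>

lemma prob_discrepancy_ge:
  fixes \<epsilon> \<alpha> b c C l :: real and m n :: nat
  assumes \<epsilon>: "0 < \<epsilon>" and \<alpha>: "0 < \<alpha>" "2 * \<alpha> \<le> l" "l \<le> 1/2" and b: "1 \<le> b"
    and C: "C = 512 * b\<^sup>2 / \<alpha>" and c: "0 \<le> c" "c\<^sup>2 = 4 * (C + 2)"
    and large: "large_size \<epsilon> \<alpha> b c n" "large_size \<epsilon> \<alpha> b c m" and mn: "n \<le> m" "real m \<le> (real n)\<^sup>2"
    and s: "\<And>i. i \<in> {1..m} \<Longrightarrow> \<bar>real (s i) - l * real n\<bar> \<le> b * real n powr (1/2 + \<epsilon>)"
    and t: "\<And>j. j \<in> {1..n} \<Longrightarrow> \<bar>real (t j) - l * real m\<bar> \<le> b * real m powr (1/2 + \<epsilon>)"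
    and sum: "(\<Sum>i=1..m. s i) = M" "(\<Sum>j=1..n. t j) = M" and M: "real M = l * (real m * real n)"
  shows "1 - exp (- real m) \<le> measure_pmf.prob (random_graph m n s t)
        {E. \<forall>A B. A \<subseteq> part_U m \<and> B \<subseteq> part_W n \<longrightarrow>
              \<bar>real (edges_between E A B) - l * real (card A) * real (card B)\<bar>
              \<le> c * (real m * real n powr (1/2 + \<epsilon>) + real n * real m powr (1/2 + \<epsilon>))}"
proof -
  define u where "u = b * real n powr (1/2 + \<epsilon>)"
  define v where "v = b * real m powr (1/2 + \<epsilon>)"
  define x where "x = c * (real m * real n powr (1/2 + \<epsilon>) + real n * real m powr (1/2 + \<epsilon>))"
  let ?I = "{1..m}" and ?J = "{1..n}"
  have pos: "1 \<le> real m" "1 \<le> real n" "{1..m} \<noteq> {}" "{1..n} \<noteq> {}"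
    using large by (auto simp: large_size_def)
  have b2: "1 \<le> b\<^sup>2" using b by (simp add: one_le_power)
  \<comment> \<open>Here \<open>y\<close> counts the lines and \<open>z\<close> is their length:
    \<open>y = m\<close>, \<open>z = n\<close> for rows, and \<open>y = n\<close>,
    \<open>z = m\<close> for columns.\<close>
  have tail: "2 * y * exp (- ((b * z powr (1/2 + \<epsilon>))\<^sup>2 / (4 * z))) \<le> 1 / (4 * (real m * real n + 1))"
    if "0 \<le> y" "y \<le> (real n)\<^sup>2" "real n \<le> z" for y z :: real
  proof -
    have "real n powr (2 * \<epsilon>) \<le> z powr (2 * \<epsilon>)" using \<epsilon> that by (intro powr_mono2) auto
    moreover have z: "0 < z" using pos that by linarith
    then have "(b * z powr (1/2 + \<epsilon>))\<^sup>2 / (4 * z) = b\<^sup>2 * z powr (2 * \<epsilon>) / 4"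
      unfolding power_mult_distrib powr_half_plus_squared[OF z] by simp
    moreover have "1 * z powr (2 * \<epsilon>) \<le> b\<^sup>2 * z powr (2 * \<epsilon>)" by (rule mult_right_mono[OF b2]) simp
    ultimately have "exp (- ((b * z powr (1/2 + \<epsilon>))\<^sup>2 / (4 * z))) \<le> exp (- (real n powr (2 * \<epsilon>) / 4))"
      by simp
    then have "2 * y * exp (- ((b * z powr (1/2 + \<epsilon>))\<^sup>2 / (4 * z))) \<le> 2 * (real n)\<^sup>2 * exp (- (real n powr (2 * \<epsilon>) / 4))"
      using that by (intro mult_mono) auto
    also have "\<dots> \<le> 1 / (4 * (real n ^ 3 + 1))" using large(1) by (simp add: large_size_def)
    also have "\<dots> \<le> 1 / (4 * (real m * real n + 1))"
    proof (rule divide_left_mono)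
      have "real m * real n \<le> (real n)\<^sup>2 * real n" by (rule mult_right_mono[OF mn(2)]) simp
      then show "4 * (real m * real n + 1) \<le> 4 * (real n ^ 3 + 1)" by (simp add: power2_eq_square power3_eq_cube)
      show "0 < 4 * (real n ^ 3 + 1) * (4 * (real m * real n + 1))" by (intro mult_pos_pos add_nonneg_pos) auto
    qed simp
    finally show ?thesis .
  qed
  have nn: "real n * 1 \<le> real n * real n" using pos by (intro mult_left_mono) auto
  have small: "2 * real m * exp (- (u\<^sup>2 / (4 * real n))) + 2 * real n * exp (- (v\<^sup>2 / (4 * real m)))
      \<le> 1 / (2 * (real m * real n + 1))"
  proof -
    have quarters: "1 / (4 * z) + 1 / (4 * z) = 1 / (2 * z)" for z :: real by simp
    have "2 * real m * exp (- (u\<^sup>2 / (4 * real n))) + 2 * real n * exp (- (v\<^sup>2 / (4 * real m)))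
      \<le> 1 / (4 * (real m * real n + 1)) + 1 / (4 * (real m * real n + 1))"
      unfolding u_def v_def
      by (intro add_mono tail) (use mn nn in \<open>auto simp: power2_eq_square\<close>)
    then show ?thesis by (simp only: quarters)
  qed
  have x0: "0 \<le> x" using c by (simp add: x_def)
  have x2: "x \<le> 2 * (real m * real n)"
  proof -
    have "real m * (c * real n powr (1/2 + \<epsilon>)) \<le> real m * real n"
      "real n * (c * real m powr (1/2 + \<epsilon>)) \<le> real n * real m"
      using large by (auto simp: large_size_def intro!: mult_left_mono)
    then show ?thesis by (simp add: x_def algebra_simps)
  qed
  have win: "2 \<le> \<alpha> * real m" "2 \<le> \<alpha> * real n" "0 \<le> u" "256 * u \<le> \<alpha> * real n" "0 \<le> v" "256 * v \<le> \<alpha> * real m"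
    using large b by (auto simp: large_size_def u_def v_def)
  have ne: "margin_class ?I ?J s t \<noteq> {}"
    by (rule deviating_fraction(1)[where \<alpha> = \<alpha> and l = l and u = u and v = v and M = M and x = x])
      (use \<alpha> win s t sum M small x0 x2 pos in \<open>auto simp: u_def v_def\<close>)
  have "card {G \<in> margin_class ?I ?J s t. deviating ?I ?J l x G} / card (margin_class ?I ?J s t)
      \<le> 2 ^ (card ?I + card ?J) * (2 * exp (- (x\<^sup>2 / (4 * (real (card ?I) * real (card ?J))))))
         * (2 * (real (card ?I) * real (card ?J) + 1) * (real (card ?J) + 1) ^ card ?I * (real (card ?I) + 1) ^ card ?J)
         / (move_cost \<alpha> u (card ?J) ^ card ?I * move_cost \<alpha> v (card ?I) ^ card ?J)"
    by (rule deviating_fraction(2)[where M = M])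
      (use \<alpha> win s t sum M small x0 x2 pos in \<open>auto simp: u_def v_def\<close>)
  also have "\<dots> \<le> exp (- real m)"
    using fraction_bound_le_exp[OF \<epsilon> \<alpha>(1) C c large x_def] by (simp add: u_def v_def)
  finally show ?thesis
    using prob_random_graph_ge[OF ne, of l x] unfolding x_def by linarith
qed

theorem theorem3p1:
  "\<exists>\<epsilon>\<^sub>0>0. \<forall>\<epsilon> K \<delta> :: real. 0 < \<epsilon> \<and> \<epsilon> < \<epsilon>\<^sub>0 \<and> 0 < K \<and> 0 < \<delta> \<longrightarrow>
     (\<exists>c>0. \<forall>m n s t. admissible \<epsilon> K \<delta> m n s t \<longrightarrow>
        (\<lambda>k. measure_pmf.prob (random_graph (m k) (n k) (s k) (t k))
           {E. \<forall>A B. A \<subseteq> part_U (m k) \<and> B \<subseteq> part_W (n k) \<longrightarrow>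
              \<bar>real (edges_between E A B)
                 - edge_density (m k) (n k) (s k) * real (card A) * real (card B)\<bar>
              \<le> c * (real (m k) * real (n k) powr (1/2 + \<epsilon>)
                    + real (n k) * real (m k) powr (1/2 + \<epsilon>))})
        \<longlonglongrightarrow> 1)"
proof (rule exI[of _ "1/4"], intro conjI allI impI)
  fix \<epsilon> K \<delta> :: real
  assume "0 < \<epsilon> \<and> \<epsilon> < 1/4 \<and> 0 < K \<and> 0 < \<delta>"
  \<comment> \<open>The bound 1/4 keeps \<open>1/2 + \<epsilon>\<close> below 1, so that windows are
    of lower order than the sizes, and \<open>1 + \<epsilon>\<close> below 2.\<close>
  then have \<epsilon>: "0 < \<epsilon>" "\<epsilon> < 1/4" and K: "0 < K" and \<delta>: "0 < \<delta>" by auto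
  \<comment> \<open>\<open>\<alpha>\<close> is half of the density bound because
    \<open>2 * \<alpha> \<le> l\<close> is required; \<open>b\<close> is at least \<open>K\<close>
    and at least 1; \<open>c\<close> solves \<open>c\<^sup>2 = 4 * (C + 2)\<close>. These constants
    depend on \<open>K\<close> and \<open>\<delta>\<close> only, not on the sequence.\<close>
  define \<alpha> where "\<alpha> = \<delta> / 2"
  define b where "b = K + 1"
  define C where "C = 512 * b\<^sup>2 / \<alpha>"
  define c where "c = 2 * sqrt (C + 2)"
  have \<alpha>: "0 < \<alpha>" and b: "1 \<le> b" "0 < b" using \<delta> K by (auto simp: \<alpha>_def b_def)
  have C: "0 \<le> C" using \<alpha> by (simp add: C_def)
  then have c: "0 < c" "c\<^sup>2 = 4 * (C + 2)" by (auto simp: c_def power_mult_distrib)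
  show "\<exists>c>0. \<forall>m n s t. admissible \<epsilon> K \<delta> m n s t \<longrightarrow>
        (\<lambda>k. measure_pmf.prob (random_graph (m k) (n k) (s k) (t k))
           {E. \<forall>A B. A \<subseteq> part_U (m k) \<and> B \<subseteq> part_W (n k) \<longrightarrow>
              \<bar>real (edges_between E A B)
                 - edge_density (m k) (n k) (s k) * real (card A) * real (card B)\<bar>
              \<le> c * (real (m k) * real (n k) powr (1/2 + \<epsilon>)
                    + real (n k) * real (m k) powr (1/2 + \<epsilon>))})
        \<longlonglongrightarrow> 1"
  proof (rule exI[of _ c], intro conjI allI impI)
    fix m n :: "nat \<Rightarrow> nat" and s t :: "nat \<Rightarrow> nat \<Rightarrow> nat"
    assume adm: "admissible \<epsilon> K \<delta> m n s t"
    have lim: "filterlim (\<lambda>k. real (m k)) at_top sequentially" "filterlim (\<lambda>k. real (n k)) at_top sequentially"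
      using adm by (auto simp: admissible_def intro: filterlim_compose[OF filterlim_real_sequentially])
    have ev: "eventually (\<lambda>k. large_size \<epsilon> \<alpha> b c (real (n k))) sequentially"
      "eventually (\<lambda>k. large_size \<epsilon> \<alpha> b c (real (m k))) sequentially"
      using eventually_large_size[OF \<epsilon> \<alpha> b(2) c(1)] lim by (auto simp: filterlim_iff)
    have "(\<lambda>k. real (m k)) \<in> o(\<lambda>k. real (n k) powr (1 + \<epsilon>))" using adm by (simp add: admissible_def)
    \<comment> \<open>The little-o relation enters with the constant 1.\<close>
    from landau_o.smallD[OF this zero_less_one]
    have ev_m: "eventually (\<lambda>k. real (m k) \<le> real (n k) powr (1 + \<epsilon>)) sequentially" by simp
    let ?P = "\<lambda>k. measure_pmf.prob (random_graph (m k) (n k) (s k) (t k))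
           {E. \<forall>A B. A \<subseteq> part_U (m k) \<and> B \<subseteq> part_W (n k) \<longrightarrow>
              \<bar>real (edges_between E A B)
                 - edge_density (m k) (n k) (s k) * real (card A) * real (card B)\<bar>
              \<le> c * (real (m k) * real (n k) powr (1/2 + \<epsilon>)
                    + real (n k) * real (m k) powr (1/2 + \<epsilon>))}"
    have lower: "eventually (\<lambda>k. 1 - exp (- real (m k)) \<le> ?P k) sequentially"
      using ev ev_m
    proof eventually_elim
      case (elim k)
      let ?l = "edge_density (m k) (n k) (s k)" and ?M = "\<Sum>i=1..m k. s k i"
      have pos: "1 \<le> real (m k)" "1 \<le> real (n k)" using elim by (auto simp: large_size_def)
      have sums: "?M = (\<Sum>j=1..n k. t k j)" using adm by (simp add: admissible_def)
      \<comment> \<open>Equality of the degree sums makes \<open>?l * m k\<close> the mean of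
        \<open>t k\<close>, and \<open>?M\<close> is the total number of edges.\<close>
      have means: "mean_degree (m k) (s k) = ?l * n k" "mean_degree (n k) (t k) = ?l * m k"
        "real ?M = ?l * (real (m k) * real (n k))"
        using pos sums by (simp_all add: mean_degree_def edge_density_def flip: of_nat_sum)
      have wider: "K * y \<le> b * y" if "0 \<le> y" for y using that by (simp add: b_def mult_right_mono)
      show ?case
      proof (rule prob_discrepancy_ge[OF \<epsilon>(1) \<alpha> _ _ b(1) C_def _ c(2) elim(1,2)])
        show "2 * \<alpha> \<le> ?l" "?l \<le> 1/2" "n k \<le> m k"
          using adm by (auto simp: admissible_def \<alpha>_def)
        have "real (n k) powr (1 + \<epsilon>) \<le> real (n k) powr 2" using \<epsilon> pos by (intro powr_mono) auto
        also have "real (n k) powr 2 = (real (n k))\<^sup>2" using pos by simp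
        finally show "real (m k) \<le> (real (n k))\<^sup>2" using elim(3) by linarith
        show "\<bar>real (s k i) - ?l * real (n k)\<bar> \<le> b * real (n k) powr (1/2 + \<epsilon>)" if "i \<in> {1..m k}" for i
        proof -
          have "\<bar>real (s k i) - mean_degree (m k) (s k)\<bar> \<le> K * real (n k) powr (1/2 + \<epsilon>)"
            using adm that unfolding admissible_def by blast
          then show ?thesis unfolding means using wider by (rule order_trans) simp
        qed
        show "\<bar>real (t k j) - ?l * real (m k)\<bar> \<le> b * real (m k) powr (1/2 + \<epsilon>)" if "j \<in> {1..n k}" for j
        proof -
          have "\<bar>real (t k j) - mean_degree (n k) (t k)\<bar> \<le> K * real (m k) powr (1/2 + \<epsilon>)"
            using adm that unfolding admissible_def by blast
          then show ?thesis unfolding means using wider by (rule order_trans) simp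
        qed
        show "(\<Sum>j=1..n k. t k j) = ?M" using sums by simp
      qed (use c means(3) in auto)
    qed
    \<comment> \<open>The exceptional probability is eventually at most
      \<open>exp (- m k)\<close>.\<close>
    show "?P \<longlonglongrightarrow> 1"
    proof (rule tendsto_sandwich[OF lower])
      have "(\<lambda>k. exp (- real (m k))) \<longlonglongrightarrow> 0"
        using lim(1) by (intro filterlim_compose[OF exp_at_bot]) (simp add: filterlim_uminus_at_bot)
      from tendsto_diff[OF tendsto_const this, of 1]
      show "(\<lambda>k. 1 - exp (- real (m k))) \<longlonglongrightarrow> 1" by simp
    qed auto
  qed (rule c)
qed simp

end
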